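(* Consider a purely kinetic Chaplygin system $(L=\frac12 g,\mathcal D)$ with symmetry group $G$ and bundle $\pi:Q\to Q/G$, and let $F=f\circ\pi$ with $f\in C^\infty(Q/G)$. If the couple $(\overline g_{ai}=-G_{ai},F=f\circ\pi)$ satisfies the condition (for all $c$ and all values of $(v^a)$) $$(A')\quad g_{bd}\left(\delta_a^dX_c(F)-\delta_c^dX_a(F)\right)v^av^b+\theta_kR^k_{ac}v^a=0,\qquad\theta_k=\overline g_{ak}v^a,$$ then it also satisfies the condition (for all $i$ and all values of $(v^a)$) $$(B')\quad \Gamma^{nh}(\theta_i)+\lambda_i+\theta_k\left(R^k_{ia}+\delta^k_iX_a(F)\right)v^a-g_{ab}X_i(F)v^av^b=0,$$ i.e. the couple $(\overline g_{ai}=-G_{ai},F=f\circ\pi)$ is a projective geodesic extension.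
   Context: Setting: $Q$ is an $n$-dimensional manifold with Riemannian metric $g$, $\mathcal D\subset TQ$ is a distribution of rank $m$, $L(v)=\frac12g(v,v)$. The system is a (purely kinetic) Chaplygin system: a Lie group $G$ acts freely and properly on $Q$, $\pi:Q\to Q/G$ is the principal bundle, $g$ and $\mathcal D$ are $G$-invariant, and $\mathcal D$ is the horizontal distribution of a principal connection on $\pi$ (so $TQ=\mathcal D\oplus V\pi$, with $V\pi=\ker T\pi$, and $\dim Q/G=m$). Indices $a,b,c,d=1,\dots,m$; $i,j,k=1,\dots,n-m$. Summation convention is used. Frames: $V_i$ are the infinitesimal generators of a basis of the Lie algebra of $G$; $X_a$ are the horizontal lifts of the coordinate fields $\partial/\partial q^a$ on $Q/G$. Set $G_{ab}=g(X_a,X_b)$ (inverse $G^{ab}$), $G_{ai}=g(X_a,V_i)$, $K^b_i=-G^{ab}G_{ai}$, $X_i=V_i+K^b_iX_b$. Then $\{X_a,X_i\}$ is a local frame with $X_a$ spanning $\mathcal D$ and $X_i$ spanning its $g$-orthogonal complement. Write $[X_\alpha,X_\beta]=R^\gamma_{\alpha\beta}X_\gamma$ in this frame, $g_{ab}=G_{ab}$, $g_{ij}=g(X_i,X_j)$, $\overline g_{ai}=\overline g(X_a,X_i)$; $v^a,v^i$ are the components of tangent vectors in this frame ($\mathcal D$ is $v^i=0$). With $\nabla$ the Levi-Civita connection of $g$, $\nabla_{X_a}X_b=\Gamma^c_{ab}X_c+\Gamma^i_{ab}X_i$. Here $\overline g$ is a $\mathcal D$-preserving modification of $g$, i.e.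 a symmetric $(0,2)$-tensor field with $\overline g|_{\mathcal D\times\mathcal D}=g|_{\mathcal D\times\mathcal D}$; the condition $\overline g_{ai}=-G_{ai}$ is equivalent to $\overline g|_{V\pi\times\mathcal D}=0$. A couple $(\overline g_{ai},F)$ is called a projective geodesic extension when it satisfies $(A')$ and $(B')$. The nonholonomic vector field $\Gamma^{nh}$ is the vector field on the manifold $\mathcal D$ whose integral curves satisfy $\dot q=v^aX_a(q)$, $\dot v^d=-\Gamma^d_{ab}v^av^b$; so $\Gamma^{nh}(\theta_bv^b)=(X_a(\theta_b)-\theta_d\Gamma^d_{ab})v^av^b$ for functions $\theta_b$ on $Q$. The Lagrange multipliers are $\lambda_i=g_{ki}\Gamma^k_{ab}v^av^b$. *)

theory Defs
  imports "HOL-Analysis.Analysis" "HOL-Algebra.Group_Action"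
begin

section \<open>Smooth manifolds\<close>

text \<open>
  Manifolds are types of class \<open>{t2_space, second_countable_topology}\<close> together with a smooth
  atlas that covers the type. The atlas need not be maximal; the model space is Euclidean.
\<close>

text \<open>Meant for open sets only, since derivatives are not taken within \<open>S\<close>.\<close>

primrec Ck_on :: "nat \<Rightarrow> 'a::euclidean_space set \<Rightarrow> ('a \<Rightarrow> 'b::euclidean_space) \<Rightarrow> bool" where
  "Ck_on 0 S f \<longleftrightarrow> continuous_on S f"
| "Ck_on (Suc k) S f \<longleftrightarrow> (\<forall>x\<in>S. f differentiable (at x)) \<and>
     (\<forall>v. Ck_on k S (\<lambda>x. frechet_derivative f (at x) v))"

definition smooth_on :: "'a::euclidean_space set \<Rightarrow> ('a \<Rightarrow> 'b::euclidean_space) \<Rightarrow> bool" where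
  "smooth_on S f \<longleftrightarrow> (\<forall>k. Ck_on k S f)"

type_synonym ('q, 'e) chart = "'q set \<times> ('q \<Rightarrow> 'e)"
type_synonym ('q, 'e) atlas = "('q, 'e) chart set"

definition chart_dom :: "('q, 'e) chart \<Rightarrow> 'q set" where
  "chart_dom c = fst c"

definition coords :: "('q, 'e) chart \<Rightarrow> 'q \<Rightarrow> 'e" where
  "coords c = snd c"

definition param :: "('q, 'e) chart \<Rightarrow> 'e \<Rightarrow> 'q" where
  "param c = inv_into (chart_dom c) (coords c)"

definition smooth_atlas ::
  "('q::{t2_space, second_countable_topology}, 'e::euclidean_space) atlas \<Rightarrow> bool" where
  "smooth_atlas A \<longleftrightarrow>
     (\<forall>c\<in>A. open (chart_dom c) \<and> open (coords c ` chart_dom c) \<and>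
        homeomorphism (chart_dom c) (coords c ` chart_dom c) (coords c) (param c)) \<and>
     (\<Union>c\<in>A. chart_dom c) = UNIV \<and>
     (\<forall>c\<in>A. \<forall>c'\<in>A. smooth_on (coords c ` (chart_dom c \<inter> chart_dom c')) (coords c' \<circ> param c))"

definition prod_atlas ::
  "('q, 'e) atlas \<Rightarrow> ('r, 'f) atlas \<Rightarrow> ('q \<times> 'r, 'e \<times> 'f) atlas" where
  "prod_atlas A B =
     {(chart_dom c \<times> chart_dom c', \<lambda>(p, q). (coords c p, coords c' q)) | c c'. c \<in> A \<and> c' \<in> B}"

definition smooth_fun_on ::
  "('q::topological_space, 'e::euclidean_space) atlas \<Rightarrow> 'q set \<Rightarrow> ('q \<Rightarrow> real) \<Rightarrow> bool" where
  "smooth_fun_on A S f \<longleftrightarrow> open S \<and> (\<forall>c\<in>A. smooth_on (coords c ` (chart_dom c \<inter> S)) (f \<circ> param c))"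

definition smooth_fun_at ::
  "('q::topological_space, 'e::euclidean_space) atlas \<Rightarrow> 'q \<Rightarrow> ('q \<Rightarrow> real) \<Rightarrow> bool" where
  "smooth_fun_at A p f \<longleftrightarrow> (\<exists>S. p \<in> S \<and> smooth_fun_on A S f)"

definition smooth_map ::
  "('q::topological_space, 'e::euclidean_space) atlas \<Rightarrow>
   ('r::topological_space, 'f::euclidean_space) atlas \<Rightarrow> ('q \<Rightarrow> 'r) \<Rightarrow> bool" where
  "smooth_map A B h \<longleftrightarrow> continuous_on UNIV h \<and>
     (\<forall>c\<in>A. \<forall>c'\<in>B.
        smooth_on (coords c ` (chart_dom c \<inter> h -` chart_dom c')) (coords c' \<circ> h \<circ> param c))"


section \<open>Tangent vectors, vector fields and tensors\<close>

text \<open>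
  A tangent vector at \<open>p\<close> is identified with the directional derivative it induces on the
  functions that are smooth near \<open>p\<close>; on all other functions its value is set to \<open>0\<close>, so that a
  tangent vector is determined by its action on smooth germs. Linear operations are pointwise and
  the zero vector is \<open>\<lambda>_. 0\<close>.
\<close>

type_synonym 'q tvec = "('q \<Rightarrow> real) \<Rightarrow> real"
type_synonym 'q vfield = "'q \<Rightarrow> 'q tvec"
type_synonym 'q tensor2 = "'q \<Rightarrow> 'q tvec \<Rightarrow> 'q tvec \<Rightarrow> real"

definition chart_deriv ::
  "('q::topological_space, 'e::euclidean_space) atlas \<Rightarrow> ('q, 'e) chart \<Rightarrow> 'q \<Rightarrow> 'e \<Rightarrow> 'q tvec" where
  "chart_deriv A c p u = (\<lambda>f. if smooth_fun_at A p f
     then frechet_derivative (f \<circ> param c) (at (coords c p)) u else 0)"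

definition tangent_space ::
  "('q::topological_space, 'e::euclidean_space) atlas \<Rightarrow> 'q \<Rightarrow> 'q tvec set" where
  "tangent_space A p = {chart_deriv A c p u | c u. c \<in> A \<and> p \<in> chart_dom c}"

text \<open>The differential of \<open>h\<close> applied to a tangent vector \<open>v\<close> at \<open>p\<close>; \<open>B\<close> is the atlas of the
  target manifold.\<close>

definition tangent_map ::
  "('r::topological_space, 'f::euclidean_space) atlas \<Rightarrow> ('q \<Rightarrow> 'r) \<Rightarrow> 'q \<Rightarrow> 'q tvec \<Rightarrow> 'r tvec" where
  "tangent_map B h p v = (\<lambda>f. if smooth_fun_at B (h p) f then v (f \<circ> h) else 0)"

definition lincomb :: "('i::finite \<Rightarrow> real) \<Rightarrow> ('i \<Rightarrow> 'q tvec) \<Rightarrow> 'q tvec" where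
  "lincomb r w = (\<lambda>f. \<Sum>i\<in>UNIV. r i * w i f)"

definition tvec_basis :: "('i::finite \<Rightarrow> 'q tvec) \<Rightarrow> 'q tvec set \<Rightarrow> bool" where
  "tvec_basis w T \<longleftrightarrow> T = {lincomb r w | r. True} \<and>
     (\<forall>r. lincomb r w = (\<lambda>_. 0) \<longrightarrow> (\<forall>i. r i = 0))"

definition smooth_vfield_on ::
  "('q::topological_space, 'e::euclidean_space) atlas \<Rightarrow> 'q set \<Rightarrow> 'q vfield \<Rightarrow> bool" where
  "smooth_vfield_on A S X \<longleftrightarrow> open S \<and> (\<forall>p\<in>S. X p \<in> tangent_space A p) \<and>
     (\<forall>W f. W \<subseteq> S \<longrightarrow> smooth_fun_on A W f \<longrightarrow> smooth_fun_on A W (\<lambda>p. X p f))"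

definition lie_bracket ::
  "('q::topological_space, 'e::euclidean_space) atlas \<Rightarrow> 'q vfield \<Rightarrow> 'q vfield \<Rightarrow> 'q vfield" where
  "lie_bracket A X Y p = (\<lambda>f. if smooth_fun_at A p f
     then X p (\<lambda>q. Y q f) - Y p (\<lambda>q. X q f) else 0)"

definition smooth_tensor2 ::
  "('q::topological_space, 'e::euclidean_space) atlas \<Rightarrow> 'q tensor2 \<Rightarrow> bool" where
  "smooth_tensor2 A h \<longleftrightarrow>
     (\<forall>p. \<forall>u\<in>tangent_space A p. \<forall>v\<in>tangent_space A p. \<forall>w\<in>tangent_space A p. \<forall>r s.
        h p (\<lambda>f. r * u f + s * v f) w = r * h p u w + s * h p v w \<and>
        h p w (\<lambda>f. r * u f + s * v f) = r * h p w u + s * h p w v) \<and>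
     (\<forall>S X Y. smooth_vfield_on A S X \<longrightarrow> smooth_vfield_on A S Y \<longrightarrow>
        smooth_fun_on A S (\<lambda>p. h p (X p) (Y p)))"

definition symmetric_tensor2 ::
  "('q::topological_space, 'e::euclidean_space) atlas \<Rightarrow> 'q tensor2 \<Rightarrow> bool" where
  "symmetric_tensor2 A h \<longleftrightarrow> smooth_tensor2 A h \<and>
     (\<forall>p. \<forall>u\<in>tangent_space A p. \<forall>v\<in>tangent_space A p. h p u v = h p v u)"

definition riemannian_metric ::
  "('q::topological_space, 'e::euclidean_space) atlas \<Rightarrow> 'q tensor2 \<Rightarrow> bool" where
  "riemannian_metric A g \<longleftrightarrow> symmetric_tensor2 A g \<and>
     (\<forall>p. \<forall>v\<in>tangent_space A p. v \<noteq> (\<lambda>_. 0) \<longrightarrow> g p v v > 0)"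

text \<open>
  The axioms are imposed on vector fields over arbitrary open sets; they make
  \<open>nabla X Y p\<close> depend only on the germs of \<open>X\<close> and \<open>Y\<close> at \<open>p\<close>.
\<close>

definition levi_civita ::
  "('q::topological_space, 'e::euclidean_space) atlas \<Rightarrow> 'q tensor2 \<Rightarrow>
   ('q vfield \<Rightarrow> 'q vfield \<Rightarrow> 'q vfield) \<Rightarrow> bool" where
  "levi_civita A g nabla \<longleftrightarrow>
     (\<forall>S X Y Z h. smooth_vfield_on A S X \<longrightarrow> smooth_vfield_on A S Y \<longrightarrow> smooth_vfield_on A S Z \<longrightarrow>
        smooth_fun_on A S h \<longrightarrow>
        smooth_vfield_on A S (nabla X Y) \<and>
        (\<forall>p\<in>S.
           nabla (\<lambda>q f. X q f + Y q f) Z p = (\<lambda>f. nabla X Z p f + nabla Y Z p f) \<and>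
           nabla X (\<lambda>q f. Y q f + Z q f) p = (\<lambda>f. nabla X Y p f + nabla X Z p f) \<and>
           nabla (\<lambda>q f. h q * X q f) Y p = (\<lambda>f. h p * nabla X Y p f) \<and>
           nabla X (\<lambda>q f. h q * Y q f) p = (\<lambda>f. X p h * Y p f + h p * nabla X Y p f) \<and>
           lie_bracket A X Y p = (\<lambda>f. nabla X Y p f - nabla Y X p f) \<and>
           X p (\<lambda>q. g q (Y q) (Z q)) = g p (nabla X Y p) (Z p) + g p (Y p) (nabla X Z p)))"

text \<open>A distribution whose rank is the cardinality of the index type \<open>'m\<close>.\<close>

definition smooth_distribution ::
  "('q::topological_space, 'e::euclidean_space) atlas \<Rightarrow> 'm::finite itself \<Rightarrow>
   ('q \<Rightarrow> 'q tvec set) \<Rightarrow> bool" where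
  "smooth_distribution A _ D \<longleftrightarrow>
     (\<forall>p. \<exists>S (Y :: 'm \<Rightarrow> 'q vfield). p \<in> S \<and> (\<forall>a. smooth_vfield_on A S (Y a)) \<and>
        (\<forall>q\<in>S. tvec_basis (\<lambda>a. Y a q) (D q)))"


section \<open>Lie group actions and principal bundles\<close>

definition lie_group ::
  "('g::{t2_space, second_countable_topology}, 'e::euclidean_space) atlas \<Rightarrow> 'g monoid \<Rightarrow> bool" where
  "lie_group A G \<longleftrightarrow> smooth_atlas A \<and> group G \<and> carrier G = UNIV \<and>
     smooth_map (prod_atlas A A) A (\<lambda>(x, y). x \<otimes>\<^bsub>G\<^esub> y) \<and> smooth_map A A (m_inv G)"

definition free_proper_action ::
  "('g::{t2_space, second_countable_topology}, 'l::euclidean_space) atlas \<Rightarrow> 'g monoid \<Rightarrow>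
   ('q::{t2_space, second_countable_topology}, 'e::euclidean_space) atlas \<Rightarrow>
   ('g \<Rightarrow> 'q \<Rightarrow> 'q) \<Rightarrow> bool" where
  "free_proper_action AG G AQ act \<longleftrightarrow>
     group_action G UNIV act \<and> smooth_map (prod_atlas AG AQ) AQ (\<lambda>(x, q). act x q) \<and>
     (\<forall>x q. act x q = q \<longrightarrow> x = \<one>\<^bsub>G\<^esub>) \<and>
     proper_map euclidean euclidean (\<lambda>(x, q). (act x q, q))"

text \<open>
  The orbit space is given, up to the unique compatible diffeomorphism, as a manifold with a
  surjective submersion \<open>\<pi>\<close> whose fibres are the orbits.
\<close>

definition orbit_bundle ::
  "'g monoid \<Rightarrow> ('q::{t2_space, second_countable_topology}, 'e::euclidean_space) atlas \<Rightarrow>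
   ('g \<Rightarrow> 'q \<Rightarrow> 'q) \<Rightarrow>
   ('b::{t2_space, second_countable_topology}, 'f::euclidean_space) atlas \<Rightarrow> ('q \<Rightarrow> 'b) \<Rightarrow> bool" where
  "orbit_bundle G AQ act AB \<pi> \<longleftrightarrow>
     smooth_atlas AB \<and> smooth_map AQ AB \<pi> \<and> surj \<pi> \<and>
     (\<forall>p. tangent_map AB \<pi> p ` tangent_space AQ p = tangent_space AB (\<pi> p)) \<and>
     (\<forall>p q. \<pi> p = \<pi> q \<longleftrightarrow> q \<in> orbit G act p)"

definition vertical ::
  "('q::topological_space, 'e::euclidean_space) atlas \<Rightarrow>
   ('b::topological_space, 'f::euclidean_space) atlas \<Rightarrow> ('q \<Rightarrow> 'b) \<Rightarrow> 'q \<Rightarrow> 'q tvec set" where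
  "vertical AQ AB \<pi> p = {v \<in> tangent_space AQ p. tangent_map AB \<pi> p v = (\<lambda>_. 0)}"

definition invariant_tensor2 ::
  "('q::topological_space, 'e::euclidean_space) atlas \<Rightarrow> ('g \<Rightarrow> 'q \<Rightarrow> 'q) \<Rightarrow> 'q tensor2 \<Rightarrow> bool" where
  "invariant_tensor2 AQ act h \<longleftrightarrow>
     (\<forall>x p. \<forall>u\<in>tangent_space AQ p. \<forall>v\<in>tangent_space AQ p.
        h (act x p) (tangent_map AQ (act x) p u) (tangent_map AQ (act x) p v) = h p u v)"

definition invariant_distribution ::
  "('q::topological_space, 'e::euclidean_space) atlas \<Rightarrow> ('g \<Rightarrow> 'q \<Rightarrow> 'q) \<Rightarrow>
   ('q \<Rightarrow> 'q tvec set) \<Rightarrow> bool" where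
  "invariant_distribution AQ act D \<longleftrightarrow> (\<forall>x p. tangent_map AQ (act x) p ` D p = D (act x p))"

text \<open>\<open>D\<close> is the horizontal distribution of a principal connection on \<open>\<pi>\<close>.\<close>

definition principal_connection ::
  "('q::topological_space, 'e::euclidean_space) atlas \<Rightarrow>
   ('g \<Rightarrow> 'q \<Rightarrow> 'q) \<Rightarrow> ('b::topological_space, real ^ 'm) atlas \<Rightarrow> ('q \<Rightarrow> 'b) \<Rightarrow>
   ('q \<Rightarrow> 'q tvec set) \<Rightarrow> bool" where
  "principal_connection AQ act AB \<pi> D \<longleftrightarrow>
     smooth_distribution AQ TYPE('m) D \<and> invariant_distribution AQ act D \<and>
     (\<forall>p. D p \<inter> vertical AQ AB \<pi> p = {\<lambda>_. 0} \<and>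
        tangent_space AQ p = {(\<lambda>f. u f + w f) | u w. u \<in> D p \<and> w \<in> vertical AQ AB \<pi> p})"

text \<open>
  A purely kinetic Chaplygin system, with \<open>L v = g v v / 2\<close>: \<open>m\<close> is the dimension of the base
  and the rank of \<open>D\<close>, \<open>l\<close> the dimension \<open>n - m\<close> of the group.
\<close>

definition chaplygin_system ::
  "('q::{t2_space, second_countable_topology}, real ^ 'n) atlas \<Rightarrow>
   ('g::{t2_space, second_countable_topology}, real ^ 'l) atlas \<Rightarrow> 'g monoid \<Rightarrow>
   ('g \<Rightarrow> 'q \<Rightarrow> 'q) \<Rightarrow>
   ('b::{t2_space, second_countable_topology}, real ^ 'm) atlas \<Rightarrow> ('q \<Rightarrow> 'b) \<Rightarrow>
   'q tensor2 \<Rightarrow> ('q \<Rightarrow> 'q tvec set) \<Rightarrow> bool" where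
  "chaplygin_system AQ AG G act AB \<pi> g D \<longleftrightarrow>
     CARD('n) = CARD('m) + CARD('l) \<and>
     smooth_atlas AQ \<and> lie_group AG G \<and> free_proper_action AG G AQ act \<and>
     orbit_bundle G AQ act AB \<pi> \<and>
     riemannian_metric AQ g \<and> invariant_tensor2 AQ act g \<and>
     principal_connection AQ act AB \<pi> D"


section \<open>The adapted frame\<close>

definition infinitesimal_generator ::
  "('q::topological_space, 'e::euclidean_space) atlas \<Rightarrow> 'g monoid \<Rightarrow> ('g \<Rightarrow> 'q \<Rightarrow> 'q) \<Rightarrow>
   'g tvec \<Rightarrow> 'q vfield" where
  "infinitesimal_generator AQ G act \<xi> q = tangent_map AQ (\<lambda>x. act x q) \<one>\<^bsub>G\<^esub> \<xi>"

definition coord_vfield ::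
  "('b::topological_space, real ^ 'm) atlas \<Rightarrow> ('b, real ^ 'm) chart \<Rightarrow> 'm \<Rightarrow> 'b vfield" where
  "coord_vfield AB c a b = chart_deriv AB c b (axis a 1)"

definition horizontal_lift_on ::
  "('q::topological_space, 'e::euclidean_space) atlas \<Rightarrow>
   ('b::topological_space, 'f::euclidean_space) atlas \<Rightarrow> ('q \<Rightarrow> 'b) \<Rightarrow> ('q \<Rightarrow> 'q tvec set) \<Rightarrow>
   'b set \<Rightarrow> 'b vfield \<Rightarrow> 'q vfield \<Rightarrow> bool" where
  "horizontal_lift_on AQ AB \<pi> D W Z X \<longleftrightarrow> smooth_vfield_on AQ (\<pi> -` W) X \<and>
     (\<forall>p \<in> \<pi> -` W. X p \<in> D p \<and> tangent_map AB \<pi> p (X p) = Z (\<pi> p))"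

text \<open>
  Below, \<open>X a\<close> are the horizontal lifts, \<open>V i\<close> the generators and \<open>Y i\<close> the fields
  \<open>V\<^sub>i + K\<^sup>b\<^sub>i X\<^sub>b\<close>, which are \<open>g\<close>-orthogonal to the \<open>X a\<close>.
\<close>

definition gram :: "'q tensor2 \<Rightarrow> ('m::finite \<Rightarrow> 'q vfield) \<Rightarrow> 'q \<Rightarrow> real ^ 'm ^ 'm" where
  "gram g X p = (\<chi> a b. g p (X a p) (X b p))"

definition K_coeff ::
  "'q tensor2 \<Rightarrow> ('m::finite \<Rightarrow> 'q vfield) \<Rightarrow> ('l \<Rightarrow> 'q vfield) \<Rightarrow> 'm \<Rightarrow> 'l \<Rightarrow> 'q \<Rightarrow> real" where
  "K_coeff g X V b i p = - (\<Sum>a\<in>UNIV. matrix_inv (gram g X p) $ a $ b * g p (X a p) (V i p))"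

definition orth_field ::
  "'q tensor2 \<Rightarrow> ('m::finite \<Rightarrow> 'q vfield) \<Rightarrow> ('l \<Rightarrow> 'q vfield) \<Rightarrow> 'l \<Rightarrow> 'q vfield" where
  "orth_field g X V i p = (\<lambda>f. V i p f + (\<Sum>b\<in>UNIV. K_coeff g X V b i p * X b p f))"

text \<open>In the frame indexed by \<open>'m + 'l\<close>, \<open>Inl a\<close> and \<open>Inr i\<close> play the roles of \<open>a\<close> and \<open>i\<close>.\<close>

definition frame :: "('m \<Rightarrow> 'q vfield) \<Rightarrow> ('l \<Rightarrow> 'q vfield) \<Rightarrow> 'm + 'l \<Rightarrow> 'q vfield" where
  "frame X Y = case_sum X Y"

text \<open>\<open>R \<gamma> \<alpha> \<beta> p\<close> is \<open>R\<^sup>\<gamma>\<^sub>\<alpha>\<^sub>\<beta>\<close> at \<open>p\<close>.\<close>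

definition structure_functions_on ::
  "('q::topological_space, 'e::euclidean_space) atlas \<Rightarrow> 'q set \<Rightarrow>
   ('s::finite \<Rightarrow> 'q vfield) \<Rightarrow> ('s \<Rightarrow> 's \<Rightarrow> 's \<Rightarrow> 'q \<Rightarrow> real) \<Rightarrow> bool" where
  "structure_functions_on A U E R \<longleftrightarrow> (\<forall>p\<in>U. \<forall>\<alpha> \<beta>.
     lie_bracket A (E \<alpha>) (E \<beta>) p = lincomb (\<lambda>\<gamma>. R \<gamma> \<alpha> \<beta> p) (\<lambda>\<gamma>. E \<gamma> p))"

text \<open>\<open>\<Gamma> \<gamma> a b p\<close> is \<open>\<Gamma>\<^sup>\<gamma>\<^sub>a\<^sub>b\<close> at \<open>p\<close>.\<close>

definition connection_coefficients_on ::
  "('q vfield \<Rightarrow> 'q vfield \<Rightarrow> 'q vfield) \<Rightarrow> 'q set \<Rightarrow>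
   ('m::finite \<Rightarrow> 'q vfield) \<Rightarrow> ('l::finite \<Rightarrow> 'q vfield) \<Rightarrow>
   ('m + 'l \<Rightarrow> 'm \<Rightarrow> 'm \<Rightarrow> 'q \<Rightarrow> real) \<Rightarrow> bool" where
  "connection_coefficients_on nabla U X Y \<Gamma> \<longleftrightarrow> (\<forall>p\<in>U. \<forall>a b.
     nabla (X a) (X b) p = lincomb (\<lambda>\<gamma>. \<Gamma> \<gamma> a b p) (\<lambda>\<gamma>. frame X Y \<gamma> p))"


section \<open>Projective geodesic extensions\<close>

definition D_preserving_modification ::
  "('q::topological_space, 'e::euclidean_space) atlas \<Rightarrow> ('q \<Rightarrow> 'q tvec set) \<Rightarrow>
   'q tensor2 \<Rightarrow> 'q tensor2 \<Rightarrow> bool" where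
  "D_preserving_modification A D g gb \<longleftrightarrow> symmetric_tensor2 A gb \<and>
     (\<forall>p. \<forall>u\<in>D p. \<forall>v\<in>D p. gb p u v = g p u v)"

text \<open>
  Functions on \<open>D\<close> are written in the coordinates \<open>(p, v)\<close> in which \<open>v\<close> stands for the vector
  \<open>v\<^sup>a X\<^sub>a\<close> of \<open>D p\<close>. The vector field with integral curves \<open>q' = v\<^sup>a X\<^sub>a\<close>,
  \<open>(v\<^sup>d)' = - \<Gamma>\<^sup>d\<^sub>a\<^sub>b v\<^sup>a v\<^sup>b\<close> acts on such functions as follows.
\<close>

definition nonholonomic_field ::
  "('m::finite \<Rightarrow> 'q vfield) \<Rightarrow> ('m + 'l \<Rightarrow> 'm \<Rightarrow> 'm \<Rightarrow> 'q \<Rightarrow> real) \<Rightarrow>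
   ('q \<Rightarrow> real ^ 'm \<Rightarrow> real) \<Rightarrow> 'q \<Rightarrow> real ^ 'm \<Rightarrow> real" where
  "nonholonomic_field X \<Gamma> \<Phi> p v =
     (\<Sum>a\<in>UNIV. v $ a * X a p (\<lambda>q. \<Phi> q v)) +
     (\<Sum>d\<in>UNIV. (- (\<Sum>a\<in>UNIV. \<Sum>b\<in>UNIV. \<Gamma> (Inl d) a b p * v $ a * v $ b)) *
        frechet_derivative (\<Phi> p) (at v) (axis d 1))"

definition theta ::
  "'q tensor2 \<Rightarrow> ('m::finite \<Rightarrow> 'q vfield) \<Rightarrow> ('l \<Rightarrow> 'q vfield) \<Rightarrow> 'l \<Rightarrow> 'q \<Rightarrow> real ^ 'm \<Rightarrow> real" where
  "theta gb X Y k p v = (\<Sum>a\<in>UNIV. gb p (X a p) (Y k p) * v $ a)"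

definition multiplier ::
  "'q tensor2 \<Rightarrow> ('l::finite \<Rightarrow> 'q vfield) \<Rightarrow> ('m::finite + 'l \<Rightarrow> 'm \<Rightarrow> 'm \<Rightarrow> 'q \<Rightarrow> real) \<Rightarrow>
   'l \<Rightarrow> 'q \<Rightarrow> real ^ 'm \<Rightarrow> real" where
  "multiplier g Y \<Gamma> i p v =
     (\<Sum>k\<in>UNIV. \<Sum>a\<in>UNIV. \<Sum>b\<in>UNIV. g p (Y k p) (Y i p) * \<Gamma> (Inr k) a b p * v $ a * v $ b)"

definition condition_A ::
  "'q set \<Rightarrow> 'q tensor2 \<Rightarrow> ('m::finite \<Rightarrow> 'q vfield) \<Rightarrow> ('l::finite \<Rightarrow> 'q vfield) \<Rightarrow>
   ('m + 'l \<Rightarrow> 'm + 'l \<Rightarrow> 'm + 'l \<Rightarrow> 'q \<Rightarrow> real) \<Rightarrow> 'q tensor2 \<Rightarrow> ('q \<Rightarrow> real) \<Rightarrow> bool" where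
  "condition_A U g X Y R gb F \<longleftrightarrow> (\<forall>p\<in>U. \<forall>c. \<forall>v :: real ^ 'm.
     (\<Sum>a\<in>UNIV. \<Sum>b\<in>UNIV. \<Sum>d\<in>UNIV. g p (X b p) (X d p) *
        ((if a = d then 1 else 0) * X c p F - (if c = d then 1 else 0) * X a p F) * v $ a * v $ b) +
     (\<Sum>k\<in>UNIV. \<Sum>a\<in>UNIV. theta gb X Y k p v * R (Inr k) (Inl a) (Inl c) p * v $ a) = 0)"

definition condition_B ::
  "'q set \<Rightarrow> 'q tensor2 \<Rightarrow> ('m::finite \<Rightarrow> 'q vfield) \<Rightarrow> ('l::finite \<Rightarrow> 'q vfield) \<Rightarrow>
   ('m + 'l \<Rightarrow> 'm + 'l \<Rightarrow> 'm + 'l \<Rightarrow> 'q \<Rightarrow> real) \<Rightarrow> ('m + 'l \<Rightarrow> 'm \<Rightarrow> 'm \<Rightarrow> 'q \<Rightarrow> real) \<Rightarrow>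
   'q tensor2 \<Rightarrow> ('q \<Rightarrow> real) \<Rightarrow> bool" where
  "condition_B U g X Y R \<Gamma> gb F \<longleftrightarrow> (\<forall>p\<in>U. \<forall>i. \<forall>v :: real ^ 'm.
     nonholonomic_field X \<Gamma> (theta gb X Y i) p v + multiplier g Y \<Gamma> i p v +
     (\<Sum>k\<in>UNIV. \<Sum>a\<in>UNIV. theta gb X Y k p v *
        (R (Inr k) (Inr i) (Inl a) p + (if k = i then 1 else 0) * X a p F) * v $ a) -
     (\<Sum>a\<in>UNIV. \<Sum>b\<in>UNIV. g p (X a p) (X b p) * Y i p F * v $ a * v $ b) = 0)"

definition projective_geodesic_extension ::
  "'q set \<Rightarrow> 'q tensor2 \<Rightarrow> ('m::finite \<Rightarrow> 'q vfield) \<Rightarrow> ('l::finite \<Rightarrow> 'q vfield) \<Rightarrow>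
   ('m + 'l \<Rightarrow> 'm + 'l \<Rightarrow> 'm + 'l \<Rightarrow> 'q \<Rightarrow> real) \<Rightarrow> ('m + 'l \<Rightarrow> 'm \<Rightarrow> 'm \<Rightarrow> 'q \<Rightarrow> real) \<Rightarrow>
   'q tensor2 \<Rightarrow> ('q \<Rightarrow> real) \<Rightarrow> bool" where
  "projective_geodesic_extension U g X Y R \<Gamma> gb F \<longleftrightarrow>
     condition_A U g X Y R gb F \<and> condition_B U g X Y R \<Gamma> gb F"

end

theory Submission
  imports Defs
begin

text \<open>
  Since \<open>g\<close> and the horizontal lifts \<open>X a\<close> are \<open>G\<close>-invariant, the generators \<open>V i\<close> commute with the
  \<open>X a\<close> and annihilate both \<open>g(X a, X b)\<close> and \<open>F = f \<circ> \<pi>\<close>. With \<open>\<theta>\<^sub>i = - g(X a, V i) v\<^sup>a\<close>, the first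
  two terms of \<open>(B')\<close> add up to \<open>- g(X b, \<nabla>\<^bsub>X a\<^esub> (V i)) v\<^sup>a v\<^sup>b\<close>, which vanishes because \<open>V i\<close> is a
  Killing field. For the rest, \<open>Y i F = K\<^sup>b\<^sub>i X b F\<close>, \<open>\<theta>\<^sub>i = G\<^sub>a\<^sub>b K\<^sup>b\<^sub>i v\<^sup>a\<close>, and the bracket \<open>[Y i, X a]\<close> equals
  \<open>- K\<^sup>b\<^sub>i [X a, X b]\<close> modulo horizontal fields; hence the remaining terms of \<open>(B')\<close> are the
  contraction of \<open>(A')\<close> with \<open>- K\<^sup>c\<^sub>i\<close>.

  The independence of the \<open>V i\<close>, which would need one-parameter subgroups, is avoided: only the sums
  \<open>\<theta>\<^sub>k R\<^sup>k\<^sub>\<alpha>\<^sub>\<beta>\<close> occur, and these depend on \<open>R\<close> only through the vertical vector \<open>R\<^sup>k\<^sub>\<alpha>\<^sub>\<beta> V k\<close>.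
\<close>

section \<open>Calculus of smooth functions\<close>

text \<open>That an invariant field commutes with a generator is usually read off from flows. Here
  tangent vectors are derivations on germs, so the bracket is evaluated on a function
  \<open>f\<close> in product coordinates on group and manifold: \<open>V i\<close> differentiates
  \<open>f (act x q)\<close> in \<open>x\<close> at the identity, an invariant field differentiates
  it in \<open>q\<close>, and the bracket is a difference of mixed second derivatives. Hence
  Schwarz's theorem for \<open>smooth_on\<close> and a calculus for maps out of a product of
  manifolds are prepared below.

  The second analytic point is the smoothness of the coefficients \<open>K\<close>, because the
  bracket \<open>[Y i, X a]\<close> differentiates them. The terms so produced,
  \<open>X\<^sub>a(K\<^sup>b\<^sub>i) X\<^sub>b\<close>, are horizontal and therefore drop out of
  every vertical comparison.

  The Killing property is used only on horizontal vectors: the bilinear form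
  \<open>g(X b, nabla (X a) (V i))\<close> is skew in \<open>a\<close> and \<open>b\<close>, and a
  skew form vanishes on the symmetric products \<open>v\<^sup>a v\<^sup>b\<close>.\<close>

lemma Ck_on_cong:
  assumes "open S" "\<And>x. x \<in> S \<Longrightarrow> f x = g x" "Ck_on k S f"
  shows "Ck_on k S g"
  using assms(2,3)
proof (induction k arbitrary: f g)
  case 0
  then show ?case by (metis Ck_on.simps(1) continuous_on_cong)
next
  case (Suc k)
  have g: "(g has_derivative frechet_derivative f (at x)) (at x)" if "x \<in> S" for x
    using Suc.prems that \<open>open S\<close>
    by (auto simp: frechet_derivative_works intro: has_derivative_transform_within_open)
  have "frechet_derivative f (at x) = frechet_derivative g (at x)" if "x \<in> S" for x
    by (rule frechet_derivative_at[OF g[OF that]])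
  moreover have "Ck_on k S (\<lambda>x. frechet_derivative f (at x) v)" for v
    using Suc.prems(2) by simp
  ultimately have "Ck_on k S (\<lambda>x. frechet_derivative g (at x) v)" for v
    using Suc.IH[of "\<lambda>x. frechet_derivative f (at x) v" "\<lambda>x. frechet_derivative g (at x) v"] by metis
  moreover have "g differentiable (at x)" if "x \<in> S" for x
    using g[OF that] by (rule differentiableI)
  ultimately show ?case
    by simp
qed

text \<open>\<open>frechet_derivative\<close> is a choice operator. Uniqueness of the derivative
  lets an explicit formula \<open>f'\<close> stand in for it, which is how the closure rules below
  run their inductions on \<open>k\<close>.\<close>

lemma Ck_on_SucI:
  assumes "open S" "\<And>x. x \<in> S \<Longrightarrow> (f has_derivative f' x) (at x)"
    and "\<And>v. Ck_on k S (\<lambda>x. f' x v)"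
  shows "Ck_on (Suc k) S f"
proof -
  have "f' x = frechet_derivative f (at x)" if "x \<in> S" for x
    by (rule frechet_derivative_at[OF assms(2)[OF that]])
  then have "Ck_on k S (\<lambda>x. frechet_derivative f (at x) v)" for v
    by (intro Ck_on_cong[OF assms(1) _ assms(3)[of v]]) simp
  then show ?thesis
    using assms(2) by (auto simp: differentiable_def)
qed

lemma Ck_on_subset: "Ck_on k S f \<Longrightarrow> T \<subseteq> S \<Longrightarrow> Ck_on k T f"
  by (induction k arbitrary: f) (auto intro: continuous_on_subset)

lemma Ck_on_Suc_imp: "Ck_on (Suc k) S f \<Longrightarrow> Ck_on k S f"
proof (induction k arbitrary: f)
  case 0
  then show ?case
    by (simp add: continuous_at_imp_continuous_on differentiable_imp_continuous_within)
qed auto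

text \<open>Derivatives at a point depend only on the germ. This is what later glues statements
  proved in single charts.\<close>

lemma Ck_on_local:
  assumes "\<And>x. x \<in> S \<Longrightarrow> \<exists>T. open T \<and> x \<in> T \<and> Ck_on k T f"
  shows "Ck_on k S f"
  using assms
proof (induction k arbitrary: f)
  case 0
  then show ?case
    by (metis Ck_on.simps(1) continuous_at_imp_continuous_on continuous_on_eq_continuous_at)
next
  case (Suc k)
  show ?case
    unfolding Ck_on.simps
  proof (intro conjI ballI allI)
    show "f differentiable at x" if "x \<in> S" for x
      using Suc.prems[OF that] by auto
    show "Ck_on k S (\<lambda>x. frechet_derivative f (at x) v)" for v
      using Suc.prems by (intro Suc.IH) fastforce
  qed
qed

lemma Ck_on_const [simp]: "Ck_on k S (\<lambda>x. c)"
  by (induction k arbitrary: c) auto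

lemma Ck_on_bounded_linear:
  assumes "open S" "bounded_linear L" "Ck_on k S f"
  shows "Ck_on k S (\<lambda>x. L (f x))"
  using assms(3)
proof (induction k arbitrary: f)
  case 0
  then show ?case using assms(2) by (simp add: bounded_linear.continuous_on)
next
  case (Suc k)
  show ?case
  proof (rule Ck_on_SucI[OF assms(1)])
    show "((\<lambda>x. L (f x)) has_derivative (\<lambda>v. L (frechet_derivative f (at x) v))) (at x)"
      if "x \<in> S" for x
      using Suc.prems that
      by (auto simp: frechet_derivative_works intro: bounded_linear.has_derivative[OF assms(2)])
    show "Ck_on k S (\<lambda>x. L (frechet_derivative f (at x) v))" for v
      using Suc by simp
  qed
qed

lemma Ck_on_add:
  assumes "open S" "Ck_on k S f" "Ck_on k S g"
  shows "Ck_on k S (\<lambda>x. f x + g x)"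
  using assms(2,3)
proof (induction k arbitrary: f g)
  case 0
  then show ?case by (simp add: continuous_on_add)
next
  case (Suc k)
  show ?case
  proof (rule Ck_on_SucI[OF assms(1)])
    show "((\<lambda>x. f x + g x) has_derivative
        (\<lambda>v. frechet_derivative f (at x) v + frechet_derivative g (at x) v)) (at x)"
      if "x \<in> S" for x
      using Suc.prems that by (auto simp: frechet_derivative_works intro: has_derivative_add)
    show "Ck_on k S (\<lambda>x. frechet_derivative f (at x) v + frechet_derivative g (at x) v)" for v
      using Suc by simp
  qed
qed

text \<open>Each term of the product rule keeps one factor undifferentiated, so the induction also
  has to lower the regularity of that factor from \<open>Suc k\<close> to \<open>k\<close>.\<close>

lemma Ck_on_bilinear:
  assumes "open S" "bounded_bilinear p" "Ck_on k S f" "Ck_on k S g"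
  shows "Ck_on k S (\<lambda>x. p (f x) (g x))"
  using assms(3,4)
proof (induction k arbitrary: f g)
  case 0
  then show ?case using assms(2) by (simp add: bounded_bilinear.continuous_on)
next
  case (Suc k)
  show ?case
  proof (rule Ck_on_SucI[OF assms(1)])
    show "((\<lambda>x. p (f x) (g x)) has_derivative (\<lambda>v. p (f x) (frechet_derivative g (at x) v) +
        p (frechet_derivative f (at x) v) (g x))) (at x)"
      if "x \<in> S" for x
      using Suc.prems that
      by (auto simp: frechet_derivative_works intro!: bounded_bilinear.FDERIV[OF assms(2)])
    show "Ck_on k S (\<lambda>x. p (f x) (frechet_derivative g (at x) v) +
        p (frechet_derivative f (at x) v) (g x))" for v
      using Suc.prems Ck_on_Suc_imp[of k S f] Ck_on_Suc_imp[of k S g]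
      by (intro Ck_on_add[OF assms(1)] Suc.IH) auto
  qed
qed

lemma Ck_on_sum:
  assumes "open S" "\<And>i. i \<in> I \<Longrightarrow> Ck_on k S (f i)"
  shows "Ck_on k S (\<lambda>x. \<Sum>i\<in>I. f i x)"
  using assms(2)
  by (induction I rule: infinite_finite_induct) (simp_all add: Ck_on_add[OF assms(1)])

lemma Ck_on_compose:
  fixes f :: "'a::euclidean_space \<Rightarrow> 'b::euclidean_space"
    and g :: "'b \<Rightarrow> 'c::euclidean_space"
  assumes "open S" "open T" "f ` S \<subseteq> T" "Ck_on k S f" "Ck_on k T g"
  shows "Ck_on k S (\<lambda>x. g (f x))"
  using assms(4,5)
proof (induction k arbitrary: g)
  case 0
  then show ?case using assms(3) by (auto intro: continuous_on_compose2)
next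
  case (Suc k)
  \<comment> \<open>The chain rule evaluates the derivative of \<open>g\<close> in a direction that
    varies with \<open>x\<close>. Expanding this direction in \<open>Basis\<close> leaves fixed
    directions \<open>b\<close>, and the induction hypothesis applies to the partial derivatives of
    \<open>g\<close> composed with \<open>f\<close>.\<close>
  let ?D = "\<lambda>x v. \<Sum>b\<in>Basis. (frechet_derivative f (at x) v \<bullet> b) *\<^sub>R frechet_derivative g (at (f x)) b"
  show ?case
  proof (rule Ck_on_SucI[OF assms(1)])
    fix x assume x: "x \<in> S"
    have f: "(f has_derivative frechet_derivative f (at x)) (at x)"
      using Suc.prems x by (auto simp: frechet_derivative_works)
    have g: "(g has_derivative frechet_derivative g (at (f x))) (at (f x))"
      using Suc.prems x assms(3) by (auto simp: frechet_derivative_works)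
    have lin: "linear (frechet_derivative g (at (f x)))"
      using g has_derivative_linear by blast
    have "frechet_derivative g (at (f x)) (frechet_derivative f (at x) v) = ?D x v" for v
      using linear_sum[OF lin] linear_scale[OF lin]
      by (metis (no_types, lifting) euclidean_representation sum.cong)
    then show "((\<lambda>x. g (f x)) has_derivative ?D x) (at x)"
      using diff_chain_at[OF f g] by (simp add: o_def)
  next
    show "Ck_on k S (\<lambda>x. ?D x v)" for v
    proof (rule Ck_on_sum[OF assms(1)], rule Ck_on_bilinear[OF assms(1) bounded_bilinear_scaleR])
      fix b :: 'b
      show "Ck_on k S (\<lambda>x. frechet_derivative f (at x) v \<bullet> b)"
        using Suc.prems by (intro Ck_on_bounded_linear[OF assms(1) bounded_linear_inner_left]) simp
      show "Ck_on k S (\<lambda>x. frechet_derivative g (at (f x)) b)"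
        using Suc.prems by (intro Suc.IH) (auto intro: Ck_on_Suc_imp)
    qed
  qed
qed

text \<open>The derivative of the reciprocal is a product of the derivative of \<open>f\<close> with
  the reciprocal itself, needed one order lower, so the induction closes.\<close>

lemma Ck_on_inverse:
  fixes f :: "'a::euclidean_space \<Rightarrow> real"
  assumes "open S" "Ck_on k S f" "\<And>x. x \<in> S \<Longrightarrow> f x \<noteq> 0"
  shows "Ck_on k S (\<lambda>x. inverse (f x))"
  using assms(2)
proof (induction k)
  case 0
  then show ?case using assms(3) by (auto intro: continuous_on_inverse)
next
  case (Suc k)
  show ?case
  proof (rule Ck_on_SucI[OF assms(1)])
    show "((\<lambda>x. inverse (f x)) has_derivative
        (\<lambda>v. - (inverse (f x) * frechet_derivative f (at x) v * inverse (f x)))) (at x)"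
      if "x \<in> S" for x
      using Suc.prems that assms(3)
      by (auto simp: frechet_derivative_works intro!: has_derivative_inverse)
    show "Ck_on k S (\<lambda>x. - (inverse (f x) * frechet_derivative f (at x) v * inverse (f x)))" for v
      using Suc.IH Suc.prems Ck_on_Suc_imp[of k S f]
      by (intro Ck_on_bounded_linear[OF assms(1) bounded_linear_minus[OF bounded_linear_ident]]
          Ck_on_bilinear[OF assms(1) bounded_bilinear_mult]) auto
  qed
qed

section \<open>Smooth functions on open subsets of a Euclidean space\<close>

lemma smooth_on_cong: "open S \<Longrightarrow> (\<And>x. x \<in> S \<Longrightarrow> f x = g x) \<Longrightarrow> smooth_on S f \<Longrightarrow> smooth_on S g"
  unfolding smooth_on_def using Ck_on_cong by blast

lemma smooth_on_subset: "smooth_on S f \<Longrightarrow> T \<subseteq> S \<Longrightarrow> smooth_on T f"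
  unfolding smooth_on_def using Ck_on_subset by blast

lemma smooth_on_local:
  "(\<And>x. x \<in> S \<Longrightarrow> \<exists>T. open T \<and> x \<in> T \<and> smooth_on T f) \<Longrightarrow> smooth_on S f"
  unfolding smooth_on_def by (meson Ck_on_local)

lemma smooth_on_const [simp]: "smooth_on S (\<lambda>x. c)"
  by (simp add: smooth_on_def)

lemma smooth_on_bounded_linear:
  "open S \<Longrightarrow> bounded_linear L \<Longrightarrow> smooth_on S f \<Longrightarrow> smooth_on S (\<lambda>x. L (f x))"
  unfolding smooth_on_def using Ck_on_bounded_linear by blast

lemma smooth_on_add:
  "open S \<Longrightarrow> smooth_on S f \<Longrightarrow> smooth_on S g \<Longrightarrow> smooth_on S (\<lambda>x. f x + g x)"
  unfolding smooth_on_def using Ck_on_add by blast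

lemma smooth_on_mult:
  fixes f g :: "'a::euclidean_space \<Rightarrow> real"
  shows "open S \<Longrightarrow> smooth_on S f \<Longrightarrow> smooth_on S g \<Longrightarrow> smooth_on S (\<lambda>x. f x * g x)"
  unfolding smooth_on_def using Ck_on_bilinear[OF _ bounded_bilinear_mult] by blast

lemma smooth_on_inverse:
  fixes f :: "'a::euclidean_space \<Rightarrow> real"
  shows "open S \<Longrightarrow> smooth_on S f \<Longrightarrow> (\<And>x. x \<in> S \<Longrightarrow> f x \<noteq> 0) \<Longrightarrow> smooth_on S (\<lambda>x. inverse (f x))"
  unfolding smooth_on_def using Ck_on_inverse by blast

lemma smooth_on_compose:
  "open S \<Longrightarrow> open T \<Longrightarrow> f ` S \<subseteq> T \<Longrightarrow> smooth_on S f \<Longrightarrow> smooth_on T g \<Longrightarrow> smooth_on S (\<lambda>x. g (f x))"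
  unfolding smooth_on_def using Ck_on_compose by blast

lemma smooth_on_ident [simp]: "smooth_on S (\<lambda>x. x)"
proof -
  have "Ck_on k S (\<lambda>x. x)" for k
    by (induction k) auto
  then show ?thesis by (simp add: smooth_on_def)
qed

lemma smooth_on_Pair:
  assumes "open S" "smooth_on S f" "smooth_on S g"
  shows "smooth_on S (\<lambda>x. (f x, g x))"
proof -
  have "bounded_linear (\<lambda>y. (y, 0))" "bounded_linear (\<lambda>y. (0, y))"
    by (auto intro: bounded_linear_Pair bounded_linear_ident bounded_linear_zero)
  from smooth_on_add[OF assms(1) smooth_on_bounded_linear[OF assms(1) this(1) assms(2)]
      smooth_on_bounded_linear[OF assms(1) this(2) assms(3)]]
  show ?thesis by simp
qed

lemma smooth_on_continuous_on: "smooth_on S f \<Longrightarrow> continuous_on S f"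
  unfolding smooth_on_def by (metis Ck_on.simps(1))

lemma smooth_on_differentiable: "smooth_on S f \<Longrightarrow> x \<in> S \<Longrightarrow> f differentiable (at x)"
  unfolding smooth_on_def by (metis Ck_on.simps(2))

lemma smooth_on_has_derivative:
  "smooth_on S f \<Longrightarrow> x \<in> S \<Longrightarrow> (f has_derivative frechet_derivative f (at x)) (at x)"
  using smooth_on_differentiable frechet_derivative_works by blast

lemma smooth_on_frechet_derivative:
  "smooth_on S f \<Longrightarrow> smooth_on S (\<lambda>x. frechet_derivative f (at x) v)"
  unfolding smooth_on_def by (metis Ck_on.simps(2))

text \<open>The mean value theorem is used twice: on the increment of \<open>f\<close> by
  \<open>r *\<^sub>R v\<close> as a function of the \<open>u\<close>-coordinate \<open>s\<close>,
  then on the resulting derivative along \<open>u\<close> as a function of the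
  \<open>v\<close>-coordinate \<open>t\<close>.\<close>

lemma second_difference_eq:
  fixes f :: "'a::euclidean_space \<Rightarrow> real"
  assumes "smooth_on S f" and r: "0 < r"
    and S: "\<And>s t. \<lbrakk>0 \<le> s; s \<le> r; 0 \<le> t; t \<le> r\<rbrakk> \<Longrightarrow> x + s *\<^sub>R u + t *\<^sub>R v \<in> S"
  shows "\<exists>s t. 0 \<le> s \<and> s \<le> r \<and> 0 \<le> t \<and> t \<le> r \<and>
    f (x + r *\<^sub>R u + r *\<^sub>R v) - f (x + r *\<^sub>R u) - f (x + r *\<^sub>R v) + f x =
    r * r * frechet_derivative (\<lambda>y. frechet_derivative f (at y) u) (at (x + s *\<^sub>R u + t *\<^sub>R v)) v"
proof -
  let ?D = "\<lambda>y. frechet_derivative f (at y)"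
  let ?E = "\<lambda>y. frechet_derivative (\<lambda>y. ?D y u) (at y)"
  have lin: "linear (?D y)" "linear (?E y)" if "y \<in> S" for y
    using that smooth_on_has_derivative[OF assms(1)] has_derivative_linear
      smooth_on_has_derivative[OF smooth_on_frechet_derivative[OF assms(1)]] by blast+
  have der: "((\<lambda>s. f (x + s *\<^sub>R u + t *\<^sub>R v)) has_derivative
      (\<lambda>h. h * ?D (x + s *\<^sub>R u + t *\<^sub>R v) u)) (at s within {0..r})"
    if "0 \<le> s" "s \<le> r" "0 \<le> t" "t \<le> r" for s t
  proof -
    have "((\<lambda>s. x + s *\<^sub>R u + t *\<^sub>R v) has_derivative (\<lambda>h. h *\<^sub>R u)) (at s)"
      by (auto intro!: derivative_eq_intros)
    from diff_chain_at[OF this smooth_on_has_derivative[OF assms(1) S]]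
    show ?thesis
      using that linear_scale[OF lin(1)[OF S]] by (auto simp: o_def intro: has_derivative_at_withinI)
  qed
  have "((\<lambda>s. f (x + s *\<^sub>R u + r *\<^sub>R v) - f (x + s *\<^sub>R u + 0 *\<^sub>R v)) has_derivative
      (\<lambda>h. h * ?D (x + s *\<^sub>R u + r *\<^sub>R v) u - h * ?D (x + s *\<^sub>R u + 0 *\<^sub>R v) u)) (at s within {0..r})"
    if "0 \<le> s" "s \<le> r" for s
    using that r by (intro has_derivative_diff der) auto
  from mvt_simple[OF r this] obtain s where "s \<in> {0<..<r}" and
    *: "f (x + r *\<^sub>R u + r *\<^sub>R v) - f (x + r *\<^sub>R u + 0 *\<^sub>R v) - (f (x + 0 *\<^sub>R u + r *\<^sub>R v) -
      f (x + 0 *\<^sub>R u + 0 *\<^sub>R v)) =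
      (r - 0) * ?D (x + s *\<^sub>R u + r *\<^sub>R v) u - (r - 0) * ?D (x + s *\<^sub>R u + 0 *\<^sub>R v) u"
    by blast
  then have s: "0 \<le> s" "s \<le> r" by auto
  have "((\<lambda>t. ?D (x + s *\<^sub>R u + t *\<^sub>R v) u) has_derivative
      (\<lambda>h. h * ?E (x + s *\<^sub>R u + t *\<^sub>R v) v)) (at t within {0..r})"
    if "0 \<le> t" "t \<le> r" for t
  proof -
    have "((\<lambda>t. x + s *\<^sub>R u + t *\<^sub>R v) has_derivative (\<lambda>h. h *\<^sub>R v)) (at t)"
      by (auto intro!: derivative_eq_intros)
    from diff_chain_at[OF this
        smooth_on_has_derivative[OF smooth_on_frechet_derivative[OF assms(1), of u] S]]
    show ?thesis
      using that s linear_scale[OF lin(2)[OF S]]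
      by (auto simp: o_def intro: has_derivative_at_withinI)
  qed
  from mvt_simple[OF r this] obtain t where "t \<in> {0<..<r}" and
    **: "?D (x + s *\<^sub>R u + r *\<^sub>R v) u - ?D (x + s *\<^sub>R u + 0 *\<^sub>R v) u =
      (r - 0) * ?E (x + s *\<^sub>R u + t *\<^sub>R v) v"
    by blast
  then have t: "0 \<le> t" "t \<le> r" by auto
  have "f (x + r *\<^sub>R u + r *\<^sub>R v) - f (x + r *\<^sub>R u) - f (x + r *\<^sub>R v) + f x =
      r * (?D (x + s *\<^sub>R u + r *\<^sub>R v) u - ?D (x + s *\<^sub>R u + 0 *\<^sub>R v) u)"
    using * by (simp add: algebra_simps)
  also have "\<dots> = r * r * ?E (x + s *\<^sub>R u + t *\<^sub>R v) v"
    unfolding ** by simp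
  finally show ?thesis
    using s t by blast
qed

text \<open>The second difference is unchanged when \<open>u\<close> and \<open>v\<close> are
  exchanged, so both mixed derivatives take a common value at points of an arbitrarily small
  parallelogram at \<open>x\<close>. Continuity makes them agree at \<open>x\<close>.\<close>

lemma smooth_on_schwarz:
  fixes f :: "'a::euclidean_space \<Rightarrow> real"
  assumes "open S" "smooth_on S f" "x \<in> S"
  shows "frechet_derivative (\<lambda>y. frechet_derivative f (at y) u) (at x) v =
    frechet_derivative (\<lambda>y. frechet_derivative f (at y) v) (at x) u"
proof -
  let ?E = "\<lambda>u v y. frechet_derivative (\<lambda>y. frechet_derivative f (at y) u) (at y) v"
  have cont: "isCont (?E u v) x" for u v
    using assms smooth_on_continuous_on[OF smooth_on_frechet_derivative[OF smooth_on_frechet_derivative]]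
      continuous_on_eq_continuous_at by blast
  have "\<bar>?E u v x - ?E v u x\<bar> < e" if "0 < e" for e
  proof -
    have lim: "(?E u v \<longlongrightarrow> ?E u v x) (nhds x)" for u v
      using cont[of u v] unfolding isCont_def by (rule tendsto_at_iff_tendsto_nhds[THEN iffD1])
    have "\<forall>\<^sub>F y in nhds x. y \<in> S \<and> dist (?E u v y) (?E u v x) < e/2 \<and> dist (?E v u y) (?E v u x) < e/2"
      using \<open>0 < e\<close>
      by (intro eventually_conj eventually_nhds_in_open assms tendstoD lim) auto
    then obtain d where d: "d > 0" and near: "\<And>y. dist y x < d \<Longrightarrow>
        y \<in> S \<and> dist (?E u v y) (?E u v x) < e/2 \<and> dist (?E v u y) (?E v u x) < e/2"
      unfolding eventually_nhds_metric by blast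
    \<comment> \<open>The summand 1 keeps \<open>N\<close> positive when \<open>u\<close> and
      \<open>v\<close> both vanish. With \<open>r = d / (2 * N)\<close> the parallelogram stays
      within distance \<open>d / 2\<close> of \<open>x\<close>.\<close>
    define N where "N = norm u + norm v + 1"
    have N: "N > 0" unfolding N_def by (simp add: add_nonneg_pos)
    define r where "r = d / (2 * N)"
    have r: "r > 0" unfolding r_def using d N by simp
    have nb: "dist (x + s *\<^sub>R u + t *\<^sub>R v) x < d" if "0 \<le> s" "s \<le> r" "0 \<le> t" "t \<le> r" for s t
    proof -
      have "norm (s *\<^sub>R u + t *\<^sub>R v) \<le> s * norm u + t * norm v"
        using that norm_triangle_ineq[of "s *\<^sub>R u" "t *\<^sub>R v"] by simp
      also have "\<dots> \<le> r * norm u + r * norm v"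
        using that by (intro add_mono mult_right_mono) auto
      also have "\<dots> \<le> r * N"
        using r by (simp add: N_def algebra_simps)
      also have "\<dots> = d / 2"
        unfolding r_def using N by simp
      finally show ?thesis using d by (simp add: dist_norm add.assoc)
    qed
    obtain s t where st: "0 \<le> s" "s \<le> r" "0 \<le> t" "t \<le> r" and eq1:
      "f (x + r *\<^sub>R u + r *\<^sub>R v) - f (x + r *\<^sub>R u) - f (x + r *\<^sub>R v) + f x =
        r * r * ?E u v (x + s *\<^sub>R u + t *\<^sub>R v)"
      using second_difference_eq[OF assms(2) r, of x u v] nb near by blast
    have "x + t *\<^sub>R v + s *\<^sub>R u \<in> S" if "0 \<le> s" "s \<le> r" "0 \<le> t" "t \<le> r" for s t
      using nb[OF that] near by (simp add: add.commute add.left_commute)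
    then obtain s' t' where st': "0 \<le> s'" "s' \<le> r" "0 \<le> t'" "t' \<le> r" and eq2:
      "f (x + r *\<^sub>R v + r *\<^sub>R u) - f (x + r *\<^sub>R v) - f (x + r *\<^sub>R u) + f x =
        r * r * ?E v u (x + t' *\<^sub>R v + s' *\<^sub>R u)"
      using second_difference_eq[OF assms(2) r, of x v u] by blast
    have "r * r * ?E u v (x + s *\<^sub>R u + t *\<^sub>R v) = r * r * ?E v u (x + s' *\<^sub>R u + t' *\<^sub>R v)"
      using eq1 eq2 by (simp add: algebra_simps)
    then have "?E u v (x + s *\<^sub>R u + t *\<^sub>R v) = ?E v u (x + s' *\<^sub>R u + t' *\<^sub>R v)"
      using r by simp
    then show ?thesis
      using near[OF nb[OF st]] near[OF nb[OF st']] unfolding dist_real_def by linarith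
  qed
  then show ?thesis
    by (metis diff_0_right eq_iff_diff_eq_0 less_irrefl zero_less_abs_iff)
qed


section \<open>Charts and tangent vectors\<close>

lemma
  assumes "smooth_atlas A" "c \<in> A"
  shows open_chart_dom: "open (chart_dom c)"
    and chart_homeomorphism: "homeomorphism (chart_dom c) (coords c ` chart_dom c) (coords c) (param c)"
    and param_coords: "p \<in> chart_dom c \<Longrightarrow> param c (coords c p) = p"
    and coords_param: "y \<in> coords c ` chart_dom c \<Longrightarrow> coords c (param c y) = y"
    and continuous_on_param: "continuous_on (coords c ` chart_dom c) (param c)"
proof -
  show "open (chart_dom c)" and h: "homeomorphism (chart_dom c) (coords c ` chart_dom c) (coords c) (param c)"
    using assms unfolding smooth_atlas_def by blast+
  then show "p \<in> chart_dom c \<Longrightarrow> param c (coords c p) = p"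
    and "y \<in> coords c ` chart_dom c \<Longrightarrow> coords c (param c y) = y"
    and "continuous_on (coords c ` chart_dom c) (param c)"
    unfolding homeomorphism_def by auto
qed

lemma chart_around:
  assumes "smooth_atlas A"
  obtains c where "c \<in> A" "p \<in> chart_dom c"
  using assms unfolding smooth_atlas_def by blast

lemma open_coords_image:
  assumes "smooth_atlas A" "c \<in> A" "open S"
  shows "open (coords c ` (chart_dom c \<inter> S))"
proof -
  have "openin (top_of_set (coords c ` chart_dom c)) (coords c ` (chart_dom c \<inter> S))"
    by (intro homeomorphism_imp_open_map[OF chart_homeomorphism[OF assms(1,2)]]
        openin_open_Int[OF assms(3)])
  moreover have "open (coords c ` chart_dom c)"
    using assms unfolding smooth_atlas_def by blast
  ultimately show ?thesis
    using openin_open_trans by blast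
qed

lemma open_coords_chart_dom:
  "smooth_atlas A \<Longrightarrow> c \<in> A \<Longrightarrow> open (coords c ` chart_dom c)"
  using open_coords_image[of A c UNIV] by simp

lemma mem_coords_image_iff:
  assumes "smooth_atlas A" "c \<in> A"
  shows "y \<in> coords c ` (chart_dom c \<inter> S) \<longleftrightarrow> y \<in> coords c ` chart_dom c \<and> param c y \<in> S"
  using param_coords[OF assms] by (auto simp: image_iff)

lemma smooth_on_transition:
  assumes "smooth_atlas A" "c \<in> A" "c' \<in> A"
  shows "smooth_on (coords c ` (chart_dom c \<inter> chart_dom c')) (\<lambda>y. coords c' (param c y))"
  using assms unfolding smooth_atlas_def by (simp add: o_def)

section \<open>Smooth functions on a manifold\<close>

lemma smooth_fun_onD:
  assumes "smooth_fun_on A S f"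
  shows "open S" "c \<in> A \<Longrightarrow> smooth_on (coords c ` (chart_dom c \<inter> S)) (\<lambda>y. f (param c y))"
  using assms unfolding smooth_fun_on_def by (auto simp: o_def)

text \<open>One chart that contains \<open>S\<close> is enough, since the smooth transition maps
  carry the local expression to every other chart.\<close>

lemma smooth_fun_onI:
  assumes A: "smooth_atlas A" "c \<in> A" and S: "open S" "S \<subseteq> chart_dom c"
    and f: "smooth_on (coords c ` S) (\<lambda>y. f (param c y))"
  shows "smooth_fun_on A S f"
  unfolding smooth_fun_on_def o_def
proof (intro conjI ballI S(1))
  fix c' assume c': "c' \<in> A"
  let ?S' = "coords c' ` (chart_dom c' \<inter> S)"
  have op: "open ?S'" "open (coords c ` S)"
    using open_coords_image[OF A(1) c' S(1)] open_coords_image[OF A S(1)] S(2)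
    by (simp_all add: Int_absorb1)
  have "smooth_on ?S' (\<lambda>y. coords c (param c' y))"
    using smooth_on_transition[OF A(1) c' A(2)] S(2) by (auto intro: smooth_on_subset)
  then have "smooth_on ?S' (\<lambda>y. f (param c (coords c (param c' y))))"
    using param_coords[OF A(1) c'] by (intro smooth_on_compose[OF op _ _ f]) auto
  then show "smooth_on ?S' (\<lambda>y. f (param c' y))"
    using param_coords[OF A(1) c'] param_coords[OF A] S(2)
    by (elim smooth_on_cong[OF op(1), rotated]) auto
qed

lemma smooth_fun_on_subset:
  "smooth_fun_on A S f \<Longrightarrow> open T \<Longrightarrow> T \<subseteq> S \<Longrightarrow> smooth_fun_on A T f"
  unfolding smooth_fun_on_def by (meson Int_mono image_mono order_refl smooth_on_subset)

lemma
  assumes "smooth_fun_on A S f" "open T"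
  shows smooth_fun_on_Int1: "smooth_fun_on A (S \<inter> T) f"
    and smooth_fun_on_Int2: "smooth_fun_on A (T \<inter> S) f"
  by (rule smooth_fun_on_subset[OF assms(1)]; use assms(2) smooth_fun_onD(1)[OF assms(1)] in blast)+

lemma smooth_fun_on_cong:
  assumes "smooth_atlas A" "smooth_fun_on A S f" "\<And>p. p \<in> S \<Longrightarrow> f p = h p"
  shows "smooth_fun_on A S h"
proof -
  have "smooth_on (coords c ` (chart_dom c \<inter> S)) (\<lambda>y. h (param c y))" if "c \<in> A" for c
    using smooth_fun_onD(2)[OF assms(2) that] assms(3) mem_coords_image_iff[OF assms(1) that]
      open_coords_image[OF assms(1) that smooth_fun_onD(1)[OF assms(2)]]
    by (elim smooth_on_cong[rotated 2]) auto
  then show ?thesis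
    using assms(2) unfolding smooth_fun_on_def by (simp add: o_def)
qed

lemma smooth_fun_on_local:
  assumes A: "smooth_atlas A" and S: "open S"
    and "\<And>p. p \<in> S \<Longrightarrow> \<exists>T. p \<in> T \<and> smooth_fun_on A T f"
  shows "smooth_fun_on A S f"
  unfolding smooth_fun_on_def o_def
proof (intro conjI ballI S smooth_on_local)
  fix c y assume c: "c \<in> A" and y: "y \<in> coords c ` (chart_dom c \<inter> S)"
  then obtain T where T: "param c y \<in> T" "smooth_fun_on A T f"
    using assms(3) mem_coords_image_iff[OF A c] by meson
  show "\<exists>T. open T \<and> y \<in> T \<and> smooth_on T (\<lambda>x. f (param c x))"
    using open_coords_image[OF A c smooth_fun_onD(1)[OF T(2)]] smooth_fun_onD(2)[OF T(2) c] y T(1)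
      mem_coords_image_iff[OF A c] by meson
qed

lemma smooth_fun_on_const [simp]: "open S \<Longrightarrow> smooth_fun_on A S (\<lambda>_. r)"
  by (simp add: smooth_fun_on_def o_def)

lemma
  assumes "smooth_atlas A" "smooth_fun_on A S f" "smooth_fun_on A S h"
  shows smooth_fun_on_add: "smooth_fun_on A S (\<lambda>p. f p + h p)"
    and smooth_fun_on_mult: "smooth_fun_on A S (\<lambda>p. f p * h p)"
  using assms open_coords_image[OF assms(1) _ smooth_fun_onD(1)[OF assms(2)]]
  by (auto simp: smooth_fun_on_def o_def intro: smooth_on_add smooth_on_mult)

lemma smooth_fun_on_inverse:
  assumes "smooth_atlas A" "smooth_fun_on A S f" "\<And>p. p \<in> S \<Longrightarrow> f p \<noteq> 0"
  shows "smooth_fun_on A S (\<lambda>p. inverse (f p))"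
  using assms open_coords_image[OF assms(1) _ smooth_fun_onD(1)[OF assms(2)]]
  by (auto simp: smooth_fun_on_def o_def param_coords[OF assms(1)] intro!: smooth_on_inverse)

lemma smooth_fun_on_sum:
  assumes "smooth_atlas A" "open S" "\<And>i. i \<in> I \<Longrightarrow> smooth_fun_on A S (f i)"
  shows "smooth_fun_on A S (\<lambda>p. \<Sum>i\<in>I. f i p)"
  using assms(3) by (induction I rule: infinite_finite_induct)
    (simp_all add: assms(2) smooth_fun_on_add[OF assms(1)])

lemma smooth_fun_on_prod:
  assumes "smooth_atlas A" "open S" "\<And>i. i \<in> I \<Longrightarrow> smooth_fun_on A S (f i)"
  shows "smooth_fun_on A S (\<lambda>p. \<Prod>i\<in>I. f i p)"
  using assms(3) by (induction I rule: infinite_finite_induct)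
    (simp_all add: assms(2) smooth_fun_on_mult[OF assms(1)])

text \<open>The determinant is a polynomial in the entries. This serves both the numerator and the
  denominator of Cramer's rule for \<open>K\<close>.\<close>

lemma smooth_fun_on_det:
  assumes "smooth_atlas A" "open S" "\<And>i j. smooth_fun_on A S (\<lambda>p. M p $ i $ j)"
  shows "smooth_fun_on A S (\<lambda>p. det (M p))"
  unfolding det_def
  by (intro smooth_fun_on_sum smooth_fun_on_mult smooth_fun_on_prod smooth_fun_on_const assms)

lemma smooth_fun_atI: "smooth_fun_on A S f \<Longrightarrow> p \<in> S \<Longrightarrow> smooth_fun_at A p f"
  unfolding smooth_fun_at_def by blast

lemma smooth_fun_at_const [simp]: "smooth_fun_at A p (\<lambda>_. r)"
  using smooth_fun_atI[OF smooth_fun_on_const[OF open_UNIV]] by blast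

lemma smooth_fun_at_cong:
  assumes "smooth_atlas A" "open S" "p \<in> S" "\<And>q. q \<in> S \<Longrightarrow> f q = h q"
  shows "smooth_fun_at A p f \<longleftrightarrow> smooth_fun_at A p h"
proof -
  have "smooth_fun_at A p h" if f: "smooth_fun_at A p f" and eq: "\<And>q. q \<in> S \<Longrightarrow> f q = h q" for f h
  proof -
    obtain T where T: "p \<in> T" "smooth_fun_on A T f"
      using f unfolding smooth_fun_at_def by blast
    have "smooth_fun_on A (S \<inter> T) f"
      by (rule smooth_fun_on_Int2[OF T(2) assms(2)])
    then have "smooth_fun_on A (S \<inter> T) h"
      by (rule smooth_fun_on_cong[OF assms(1)]) (simp add: eq)
    then show ?thesis
      using T(1) assms(3) by (auto intro: smooth_fun_atI)
  qed
  from this[of f h] this[of h f] show ?thesis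
    using assms(4) by auto
qed

lemma
  assumes "smooth_atlas A" "smooth_fun_at A p f" "smooth_fun_at A p h"
  shows smooth_fun_at_add: "smooth_fun_at A p (\<lambda>q. f q + h q)"
    and smooth_fun_at_mult: "smooth_fun_at A p (\<lambda>q. f q * h q)"
proof -
  obtain S T where "p \<in> S" "smooth_fun_on A S f" "p \<in> T" "smooth_fun_on A T h"
    using assms unfolding smooth_fun_at_def by blast
  then have p: "p \<in> S \<inter> T" and fh: "smooth_fun_on A (S \<inter> T) f" "smooth_fun_on A (S \<inter> T) h"
    by (simp_all add: smooth_fun_on_Int1 smooth_fun_on_Int2 smooth_fun_onD(1))
  show "smooth_fun_at A p (\<lambda>q. f q + h q)" "smooth_fun_at A p (\<lambda>q. f q * h q)"
    using smooth_fun_atI[OF smooth_fun_on_add[OF assms(1) fh] p]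
      smooth_fun_atI[OF smooth_fun_on_mult[OF assms(1) fh] p] .
qed

lemma smooth_fun_at_sum:
  assumes "smooth_atlas A" "\<And>i. i \<in> I \<Longrightarrow> smooth_fun_at A p (f i)"
  shows "smooth_fun_at A p (\<lambda>q. \<Sum>i\<in>I. f i q)"
  using assms(2) by (induction I rule: infinite_finite_induct)
    (simp_all add: smooth_fun_at_add[OF assms(1)])

section \<open>Tangent vectors: independence of the chart and derivation rules\<close>

lemma smooth_fun_at_has_derivative:
  assumes "smooth_atlas A" "smooth_fun_at A p f" "c \<in> A" "p \<in> chart_dom c"
  shows "((\<lambda>y. f (param c y)) has_derivative
    frechet_derivative (\<lambda>y. f (param c y)) (at (coords c p))) (at (coords c p))"
proof -
  obtain S where "p \<in> S" "smooth_fun_on A S f"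
    using assms unfolding smooth_fun_at_def by blast
  then show ?thesis
    using smooth_on_has_derivative[OF smooth_fun_onD(2)[OF _ assms(3)]] assms(4) by blast
qed

lemma chart_deriv_eqI:
  assumes "smooth_atlas A" "c \<in> A" "p \<in> chart_dom c" "smooth_fun_at A p f"
    and "((\<lambda>y. f (param c y)) has_derivative f') (at (coords c p))"
  shows "chart_deriv A c p u f = f' u"
  using assms(4) frechet_derivative_at[OF assms(5)] by (simp add: chart_deriv_def o_def)

lemma chart_deriv_change:
  assumes A: "smooth_atlas A" and c: "c \<in> A" "p \<in> chart_dom c" and c': "c' \<in> A" "p \<in> chart_dom c'"
  shows "chart_deriv A c p u =
    chart_deriv A c' p (frechet_derivative (\<lambda>y. coords c' (param c y)) (at (coords c p)) u)"
proof
  fix f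
  let ?t = "\<lambda>y. coords c' (param c y)"
  show "chart_deriv A c p u f = chart_deriv A c' p (frechet_derivative ?t (at (coords c p)) u) f"
  proof (cases "smooth_fun_at A p f")
    case True
    have t: "(?t has_derivative frechet_derivative ?t (at (coords c p))) (at (coords c p))"
      using smooth_on_has_derivative[OF smooth_on_transition[OF A c(1) c'(1)]] c c' by blast
    have "?t (coords c p) = coords c' p"
      using param_coords[OF A c] by simp
    then have "((\<lambda>y. f (param c' (?t y))) has_derivative
        (\<lambda>u. frechet_derivative (\<lambda>y. f (param c' y)) (at (coords c' p))
          (frechet_derivative ?t (at (coords c p)) u))) (at (coords c p))"
      using diff_chain_at[OF t, of "\<lambda>y. f (param c' y)"]
        smooth_fun_at_has_derivative[OF A True c'] by (simp add: o_def)
    then have "((\<lambda>y. f (param c y)) has_derivative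
        (\<lambda>u. frechet_derivative (\<lambda>y. f (param c' y)) (at (coords c' p))
          (frechet_derivative ?t (at (coords c p)) u))) (at (coords c p))"
    proof (rule has_derivative_transform_within_open)
      show "open (coords c ` (chart_dom c \<inter> chart_dom c'))"
        by (rule open_coords_image[OF A c(1) open_chart_dom[OF A c'(1)]])
      show "f (param c' (?t y)) = f (param c y)" if "y \<in> coords c ` (chart_dom c \<inter> chart_dom c')" for y
        using that param_coords[OF A c'(1)] mem_coords_image_iff[OF A c(1)] by simp
    qed (use c c' in blast)
    from chart_deriv_eqI[OF A c True this]
      chart_deriv_eqI[OF A c' True smooth_fun_at_has_derivative[OF A True c']]
    show ?thesis by simp
  qed (simp add: chart_deriv_def)
qed

text \<open>The definition collects directional derivatives from all charts at \<open>p\<close>. The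
  chain rule along a transition map moves each of them into one chart, so that any two vectors at
  \<open>p\<close> can be added by adding their coordinate vectors.\<close>

lemma tangent_space_eq:
  assumes "smooth_atlas A" "c \<in> A" "p \<in> chart_dom c"
  shows "tangent_space A p = range (chart_deriv A c p)"
proof -
  have "chart_deriv A c' p u \<in> range (chart_deriv A c p)" if "c' \<in> A" "p \<in> chart_dom c'" for c' u
    unfolding chart_deriv_change[OF assms(1) that assms(2,3)] by blast
  then show ?thesis
    unfolding tangent_space_def using assms by blast
qed

lemma tangent_vector_chart:
  assumes "smooth_atlas A" "v \<in> tangent_space A p" "c \<in> A" "p \<in> chart_dom c"
  obtains u where "v = chart_deriv A c p u"
  using assms tangent_space_eq by blast

lemma tangent_vector_not_smooth:
  "v \<in> tangent_space A p \<Longrightarrow> \<not> smooth_fun_at A p f \<Longrightarrow> v f = 0"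
  unfolding tangent_space_def by (auto simp: chart_deriv_def)

lemma tangent_space_combination:
  assumes A: "smooth_atlas A" and "v \<in> tangent_space A p" "w \<in> tangent_space A p"
  shows "(\<lambda>f. r * v f + s * w f) \<in> tangent_space A p"
proof -
  obtain c where c: "c \<in> A" "p \<in> chart_dom c"
    using chart_around[OF A] by blast
  obtain x y where v: "v = chart_deriv A c p x" and w: "w = chart_deriv A c p y"
    using assms tangent_vector_chart[OF A _ c] by metis
  have "chart_deriv A c p (r *\<^sub>R x + s *\<^sub>R y) = (\<lambda>f. r * v f + s * w f)"
  proof
    fix f
    show "chart_deriv A c p (r *\<^sub>R x + s *\<^sub>R y) f = r * v f + s * w f"
    proof (cases "smooth_fun_at A p f")
      case True
      then have "linear (frechet_derivative (\<lambda>y. f (param c y)) (at (coords c p)))"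
        using has_derivative_linear smooth_fun_at_has_derivative[OF A _ c] by blast
      then show ?thesis
        using True by (simp add: v w chart_deriv_def o_def linear_add linear_scale)
    qed (simp add: v w chart_deriv_def)
  qed
  then show ?thesis
    using tangent_space_eq[OF A c] by (metis rangeI)
qed

lemma tangent_space_zero:
  assumes "smooth_atlas A"
  shows "(\<lambda>_. 0) \<in> tangent_space A p"
proof -
  obtain c where c: "c \<in> A" "p \<in> chart_dom c"
    using chart_around[OF assms] by blast
  then have "chart_deriv A c p 0 \<in> tangent_space A p"
    using tangent_space_eq[OF assms] by blast
  from tangent_space_combination[OF assms this this, of 0 0] show ?thesis
    by simp
qed

lemma tangent_space_sum:
  assumes "smooth_atlas A" "\<And>i. i \<in> I \<Longrightarrow> w i \<in> tangent_space A p"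
  shows "(\<lambda>f. \<Sum>i\<in>I. r i * w i f) \<in> tangent_space A p"
  using assms(2)
proof (induction I rule: infinite_finite_induct)
  case (insert j I)
  then show ?case
    using tangent_space_combination[OF assms(1), of "w j" p "\<lambda>f. \<Sum>i\<in>I. r i * w i f" "r j" 1] by simp
qed (simp_all add: tangent_space_zero[OF assms(1)])

lemma tangent_space_lincomb:
  "smooth_atlas A \<Longrightarrow> (\<And>i. w i \<in> tangent_space A p) \<Longrightarrow> lincomb r w \<in> tangent_space A p"
  unfolding lincomb_def by (rule tangent_space_sum)

text \<open>If the common germ is not smooth, both values are the default 0; otherwise the two local
  expressions have the same derivative.\<close>

lemma tangent_vector_cong:
  assumes A: "smooth_atlas A" and v: "v \<in> tangent_space A p"
    and S: "open S" "p \<in> S" "\<And>q. q \<in> S \<Longrightarrow> f q = h q"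
  shows "v f = v h"
proof (cases "smooth_fun_at A p f")
  case True
  then have h: "smooth_fun_at A p h"
    using smooth_fun_at_cong[OF A S] by simp
  obtain c where c: "c \<in> A" "p \<in> chart_dom c"
    using chart_around[OF A] by blast
  obtain u where u: "v = chart_deriv A c p u"
    using tangent_vector_chart[OF A v c] .
  have "((\<lambda>y. h (param c y)) has_derivative
      frechet_derivative (\<lambda>y. f (param c y)) (at (coords c p))) (at (coords c p))"
    using smooth_fun_at_has_derivative[OF A True c] S c(2) mem_coords_image_iff[OF A c(1)]
    by (elim has_derivative_transform_within_open[OF _ open_coords_image[OF A c(1) S(1)]]) auto
  from chart_deriv_eqI[OF A c h this] chart_deriv_eqI[OF A c True smooth_fun_at_has_derivative[OF A True c]]
  show ?thesis by (simp add: u)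
next
  case False
  then show ?thesis
    using smooth_fun_at_cong[OF A S] tangent_vector_not_smooth[OF v] by simp
qed

lemma
  assumes A: "smooth_atlas A" and v: "v \<in> tangent_space A p"
    and f: "smooth_fun_at A p f" and h: "smooth_fun_at A p h"
  shows tangent_vector_add: "v (\<lambda>q. f q + h q) = v f + v h"
    and tangent_vector_mult: "v (\<lambda>q. f q * h q) = f p * v h + v f * h p"
proof -
  obtain c where c: "c \<in> A" "p \<in> chart_dom c"
    using chart_around[OF A] by blast
  obtain u where u: "v = chart_deriv A c p u"
    using tangent_vector_chart[OF A v c] .
  note f' = smooth_fun_at_has_derivative[OF A f c] and h' = smooth_fun_at_has_derivative[OF A h c]
  show "v (\<lambda>q. f q + h q) = v f + v h"
    using chart_deriv_eqI[OF A c smooth_fun_at_add[OF A f h] has_derivative_add[OF f' h']]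
      chart_deriv_eqI[OF A c f f'] chart_deriv_eqI[OF A c h h'] by (simp add: u)
  show "v (\<lambda>q. f q * h q) = f p * v h + v f * h p"
    using chart_deriv_eqI[OF A c smooth_fun_at_mult[OF A f h] has_derivative_mult[OF f' h']]
      chart_deriv_eqI[OF A c f f'] chart_deriv_eqI[OF A c h h'] by (simp add: u param_coords[OF A c])
qed

lemma tangent_vector_const:
  assumes A: "smooth_atlas A" and v: "v \<in> tangent_space A p"
  shows "v (\<lambda>_. r) = 0"
proof -
  obtain c where c: "c \<in> A" "p \<in> chart_dom c"
    using chart_around[OF A] by blast
  obtain u where u: "v = chart_deriv A c p u"
    using tangent_vector_chart[OF A v c] .
  show ?thesis
    using chart_deriv_eqI[OF A c smooth_fun_at_const has_derivative_const] by (simp add: u)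
qed

lemma tangent_vector_cmult:
  assumes "smooth_atlas A" "v \<in> tangent_space A p" "smooth_fun_at A p f"
  shows "v (\<lambda>q. r * f q) = r * v f"
  using tangent_vector_mult[OF assms(1,2) smooth_fun_at_const assms(3)] tangent_vector_const[OF assms(1,2)]
  by simp

lemma tangent_vector_sum:
  assumes "smooth_atlas A" "v \<in> tangent_space A p" "\<And>i. i \<in> I \<Longrightarrow> smooth_fun_at A p (f i)"
  shows "v (\<lambda>q. \<Sum>i\<in>I. f i q) = (\<Sum>i\<in>I. v (f i))"
  using assms(3)
proof (induction I rule: infinite_finite_induct)
  case (insert j I)
  then have "v (\<lambda>q. f j q + (\<Sum>i\<in>I. f i q)) = v (f j) + v (\<lambda>q. \<Sum>i\<in>I. f i q)"
    by (intro tangent_vector_add[OF assms(1,2)] smooth_fun_at_sum[OF assms(1)]) auto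
  then show ?case
    using insert by simp
qed (simp_all add: tangent_vector_const[OF assms(1,2)])

lemma smooth_vfield_onD:
  assumes "smooth_vfield_on A S X"
  shows "open S" "p \<in> S \<Longrightarrow> X p \<in> tangent_space A p"
    and "smooth_fun_on A W f \<Longrightarrow> W \<subseteq> S \<Longrightarrow> smooth_fun_on A W (\<lambda>p. X p f)"
  using assms unfolding smooth_vfield_on_def by blast+

lemma smooth_vfield_on_apply_smooth_at:
  assumes "smooth_vfield_on A S X" "smooth_fun_at A p f" "p \<in> S"
  shows "smooth_fun_at A p (\<lambda>q. X q f)"
proof -
  obtain T where "p \<in> T" "smooth_fun_on A T f"
    using assms unfolding smooth_fun_at_def by blast
  then have "smooth_fun_on A (S \<inter> T) (\<lambda>q. X q f)"
    by (intro smooth_vfield_onD(3)[OF assms(1)] smooth_fun_on_Int2 smooth_vfield_onD(1)[OF assms(1)]) auto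
  then show ?thesis
    using assms(3) \<open>p \<in> T\<close> by (auto intro: smooth_fun_atI)
qed

lemma smooth_vfield_on_subset:
  "smooth_vfield_on A S X \<Longrightarrow> open T \<Longrightarrow> T \<subseteq> S \<Longrightarrow> smooth_vfield_on A T X"
  unfolding smooth_vfield_on_def by blast


section \<open>Smooth maps and their differentials\<close>

lemma smooth_map_pullback:
  assumes A: "smooth_atlas A" and B: "smooth_atlas B" and h: "smooth_map A B h"
    and f: "smooth_fun_on B S f"
  shows "smooth_fun_on A (h -` S) (f \<circ> h)"
proof (rule smooth_fun_on_local[OF A])
  have vim: "open (h -` T)" if "open T" for T
    using h that unfolding smooth_map_def by (auto intro: open_vimage)
  then show "open (h -` S)"
    using smooth_fun_onD(1)[OF f] by blast
  fix p assume p: "p \<in> h -` S"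
  obtain c c' where c: "c \<in> A" "p \<in> chart_dom c" and c': "c' \<in> B" "h p \<in> chart_dom c'"
    using chart_around[OF A, of p] chart_around[OF B, of "h p"] by metis
  let ?T = "chart_dom c \<inter> h -` (chart_dom c' \<inter> S)"
  have o: "open (h -` (chart_dom c' \<inter> S))"
    using vim open_chart_dom[OF B c'(1)] smooth_fun_onD(1)[OF f] by blast
  have "smooth_on (coords c ` (chart_dom c \<inter> h -` chart_dom c')) (\<lambda>y. coords c' (h (param c y)))"
    using h c(1) c'(1) unfolding smooth_map_def o_def by blast
  then have "smooth_on (coords c ` ?T) (\<lambda>y. coords c' (h (param c y)))"
    by (rule smooth_on_subset) blast
  then have "smooth_on (coords c ` ?T) (\<lambda>y. f (param c' (coords c' (h (param c y)))))"
    using param_coords[OF A c(1)]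
    by (intro smooth_on_compose[OF open_coords_image[OF A c(1) o]
          open_coords_image[OF B c'(1) smooth_fun_onD(1)[OF f]] _ _ smooth_fun_onD(2)[OF f c'(1)]]) auto
  then have "smooth_on (coords c ` ?T) (\<lambda>y. (f \<circ> h) (param c y))"
    using param_coords[OF A c(1)] param_coords[OF B c'(1)]
    by (elim smooth_on_cong[OF open_coords_image[OF A c(1) o], rotated]) auto
  then have "smooth_fun_on A ?T (f \<circ> h)"
    using o open_chart_dom[OF A c(1)] by (intro smooth_fun_onI[OF A c(1)]) auto
  then show "\<exists>T. p \<in> T \<and> smooth_fun_on A T (f \<circ> h)"
    using p c(2) c'(2) by (intro exI[of _ ?T]) simp
qed

lemma smooth_map_pullback_at:
  assumes "smooth_atlas A" "smooth_atlas B" "smooth_map A B h" "smooth_fun_at B (h p) f"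
  shows "smooth_fun_at A p (f \<circ> h)"
  using assms smooth_map_pullback[OF assms(1-3)] unfolding smooth_fun_at_def by blast

text \<open>The coordinate vector of the image is the Jacobian of \<open>h\<close> in charts applied
  to the coordinate vector of \<open>v\<close>. On functions that are not smooth near
  \<open>h p\<close> both sides are 0 by convention.\<close>

lemma tangent_map_in_tangent_space:
  assumes A: "smooth_atlas A" and B: "smooth_atlas B" and h: "smooth_map A B h"
    and v: "v \<in> tangent_space A p"
  shows "tangent_map B h p v \<in> tangent_space B (h p)"
proof -
  obtain c c' where c: "c \<in> A" "p \<in> chart_dom c" and c': "c' \<in> B" "h p \<in> chart_dom c'"
    using chart_around[OF A, of p] chart_around[OF B, of "h p"] by metis
  obtain u where u: "v = chart_deriv A c p u"
    using tangent_vector_chart[OF A v c] .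
  let ?t = "\<lambda>y. coords c' (h (param c y))"
  let ?S = "coords c ` (chart_dom c \<inter> h -` chart_dom c')"
  have S: "open ?S" "coords c p \<in> ?S"
    using h c c' open_coords_image[OF A c(1)] open_chart_dom[OF B c'(1)]
    unfolding smooth_map_def by (auto intro: open_vimage)
  have t: "(?t has_derivative frechet_derivative ?t (at (coords c p))) (at (coords c p))"
    using h c(1) c'(1) S unfolding smooth_map_def o_def by (blast intro: smooth_on_has_derivative)
  have t0: "?t (coords c p) = coords c' (h p)"
    using param_coords[OF A c] by simp
  have "tangent_map B h p v f = chart_deriv B c' (h p) (frechet_derivative ?t (at (coords c p)) u) f" for f
  proof (cases "smooth_fun_at B (h p) f")
    case True
    note f' = smooth_fun_at_has_derivative[OF B True c']
    have "((\<lambda>y. f (param c' (?t y))) has_derivative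
        (\<lambda>u. frechet_derivative (\<lambda>y. f (param c' y)) (at (coords c' (h p)))
          (frechet_derivative ?t (at (coords c p)) u))) (at (coords c p))"
      using diff_chain_at[OF t, of "\<lambda>y. f (param c' y)"] f' t0 by (simp add: o_def)
    then have "((\<lambda>y. (f \<circ> h) (param c y)) has_derivative
        (\<lambda>u. frechet_derivative (\<lambda>y. f (param c' y)) (at (coords c' (h p)))
          (frechet_derivative ?t (at (coords c p)) u))) (at (coords c p))"
      using param_coords[OF A c(1)] param_coords[OF B c'(1)] S
      by (elim has_derivative_transform_within_open) auto
    from chart_deriv_eqI[OF A c smooth_map_pullback_at[OF A B h True] this]
      chart_deriv_eqI[OF B c' True f'] True
    show ?thesis by (simp add: tangent_map_def u o_def)
  qed (simp add: tangent_map_def chart_deriv_def)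
  then have "tangent_map B h p v = chart_deriv B c' (h p) (frechet_derivative ?t (at (coords c p)) u)"
    by (rule ext)
  then show ?thesis
    unfolding tangent_space_eq[OF B c'] by simp
qed


text \<open>The coordinate image of the part of a product chart that \<open>\<Phi>\<close> sends
  into \<open>S\<close>. It is written with \<open>param a\<close> and \<open>param b\<close> of the
  factors, because the parametrisation of a chart in \<open>prod_atlas\<close> is an opaque
  \<open>inv_into\<close>.\<close>

definition prod_chart_dom :: "('p, 'e) chart \<Rightarrow> ('r, 'f) chart \<Rightarrow> ('p \<times> 'r \<Rightarrow> 's) \<Rightarrow> 's set \<Rightarrow> ('e \<times> 'f) set" where
  "prod_chart_dom a b \<Phi> S =
     {w \<in> coords a ` chart_dom a \<times> coords b ` chart_dom b. \<Phi> (param a (fst w), param b (snd w)) \<in> S}"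

section \<open>Smooth maps out of a product of two manifolds\<close>

context
  fixes A :: "('p::{t2_space, second_countable_topology}, 'e::euclidean_space) atlas"
    and B :: "('r::{t2_space, second_countable_topology}, 'f::euclidean_space) atlas"
    and C :: "('s::{t2_space, second_countable_topology}, 'h::euclidean_space) atlas"
    and \<Phi> :: "'p \<times> 'r \<Rightarrow> 's"
  assumes A: "smooth_atlas A" and B: "smooth_atlas B" and C: "smooth_atlas C"
    and \<Phi>: "smooth_map (prod_atlas A B) C \<Phi>"
begin

lemma continuous_on_prod_map: "continuous_on UNIV \<Phi>"
  using \<Phi> unfolding smooth_map_def by blast

lemma open_prod_chart_dom:
  assumes "a \<in> A" "b \<in> B" "open S"
  shows "open (prod_chart_dom a b \<Phi> S)"
proof -
  let ?E = "coords a ` chart_dom a \<times> coords b ` chart_dom b"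
  have "continuous_on ?E (\<lambda>w. \<Phi> (param a (fst w), param b (snd w)))"
  proof (rule continuous_on_compose2[OF continuous_on_prod_map continuous_on_Pair subset_UNIV])
    show "continuous_on ?E (\<lambda>w. param a (fst w))"
      by (rule continuous_on_compose2[OF continuous_on_param[OF A assms(1)]
            continuous_on_fst[OF continuous_on_id]]) auto
    show "continuous_on ?E (\<lambda>w. param b (snd w))"
      by (rule continuous_on_compose2[OF continuous_on_param[OF B assms(2)]
            continuous_on_snd[OF continuous_on_id]]) auto
  qed
  moreover have "open ?E"
    by (intro open_Times open_coords_chart_dom[OF A assms(1)] open_coords_chart_dom[OF B assms(2)])
  ultimately have "open (?E \<inter> (\<lambda>w. \<Phi> (param a (fst w), param b (snd w))) -` S)"
    using continuous_open_preimage assms(3) by blast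
  also have "?E \<inter> (\<lambda>w. \<Phi> (param a (fst w), param b (snd w))) -` S = prod_chart_dom a b \<Phi> S"
    unfolding prod_chart_dom_def by auto
  finally show ?thesis .
qed

lemma smooth_on_prod_chart:
  assumes "a \<in> A" "b \<in> B" "c \<in> C"
  shows "smooth_on (prod_chart_dom a b \<Phi> (chart_dom c))
    (\<lambda>w. coords c (\<Phi> (param a (fst w), param b (snd w))))"
proof -
  define k where "k = (chart_dom a \<times> chart_dom b, \<lambda>(p, q). (coords a p, coords b q))"
  have k: "chart_dom k = chart_dom a \<times> chart_dom b" "coords k = (\<lambda>(p, q). (coords a p, coords b q))"
    by (simp_all add: k_def chart_dom_def coords_def)
  \<comment> \<open>\<open>param k\<close> is an \<open>inv_into\<close>; injectivity of the product
    coordinates identifies it with the pair of \<open>param a\<close> and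
    \<open>param b\<close>.\<close>
  have "inj_on (coords k) (chart_dom k)"
    unfolding k inj_on_def using param_coords[OF A assms(1)] param_coords[OF B assms(2)]
    by clarsimp metis
  then have pk: "param k (coords a p, coords b q) = (p, q)" if "p \<in> chart_dom a" "q \<in> chart_dom b" for p q
    using inv_into_f_f[of "coords k" "chart_dom k" "(p, q)"] that by (simp add: param_def k)
  have im: "coords k ` (chart_dom k \<inter> \<Phi> -` chart_dom c) = prod_chart_dom a b \<Phi> (chart_dom c)"
    unfolding prod_chart_dom_def k
    using param_coords[OF A assms(1)] param_coords[OF B assms(2)] by (auto simp: image_iff)
  have "k \<in> prod_atlas A B"
    using assms(1,2) unfolding prod_atlas_def k_def by blast
  then have "smooth_on (prod_chart_dom a b \<Phi> (chart_dom c)) (coords c \<circ> \<Phi> \<circ> param k)"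
    using \<Phi> assms(3) unfolding smooth_map_def im[symmetric] by blast
  then show ?thesis
    using pk param_coords[OF A assms(1)] param_coords[OF B assms(2)]
    by (elim smooth_on_cong[OF open_prod_chart_dom[OF assms(1,2) open_chart_dom[OF C assms(3)]], rotated])
      (auto simp: prod_chart_dom_def)
qed

text \<open>\<open>smooth_map_pullback\<close> would ask for \<open>prod_atlas A B\<close> to be a
  smooth atlas. Composing with a chart of the target near each point, in the coordinates of the
  factors, avoids this.\<close>

lemma smooth_on_prod_pullback:
  assumes "a \<in> A" "b \<in> B" and f: "smooth_fun_on C S f"
  shows "smooth_on (prod_chart_dom a b \<Phi> S) (\<lambda>w. f (\<Phi> (param a (fst w), param b (snd w))))"
proof (rule smooth_on_local)
  let ?\<Phi> = "\<lambda>w. \<Phi> (param a (fst w), param b (snd w))"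
  fix w assume w: "w \<in> prod_chart_dom a b \<Phi> S"
  obtain c where c: "c \<in> C" "?\<Phi> w \<in> chart_dom c"
    using chart_around[OF C] by blast
  let ?T = "prod_chart_dom a b \<Phi> (chart_dom c \<inter> S)"
  have o: "open ?T"
    using open_prod_chart_dom[OF assms(1,2)] open_chart_dom[OF C c(1)] smooth_fun_onD(1)[OF f] by blast
  have "smooth_on ?T (\<lambda>w. coords c (?\<Phi> w))"
    using smooth_on_prod_chart[OF assms(1,2) c(1)]
    by (rule smooth_on_subset) (auto simp: prod_chart_dom_def)
  then have "smooth_on ?T (\<lambda>w. f (param c (coords c (?\<Phi> w))))"
    by (intro smooth_on_compose[OF o open_coords_image[OF C c(1) smooth_fun_onD(1)[OF f]] _ _
          smooth_fun_onD(2)[OF f c(1)]]) (auto simp: prod_chart_dom_def)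
  then have "smooth_on ?T (\<lambda>w. f (?\<Phi> w))"
    by (elim smooth_on_cong[OF o, rotated]) (auto simp: prod_chart_dom_def param_coords[OF C c(1)])
  moreover have "w \<in> ?T"
    using w c(2) by (simp add: prod_chart_dom_def)
  ultimately show "\<exists>T. open T \<and> w \<in> T \<and> smooth_on T (\<lambda>w. f (?\<Phi> w))"
    using o by blast
qed

lemma smooth_map_prod_slice1: "smooth_map A C (\<lambda>x. \<Phi> (x, q))"
  unfolding smooth_map_def o_def
proof (intro conjI ballI)
  show cont: "continuous_on UNIV (\<lambda>x. \<Phi> (x, q))"
    by (rule continuous_on_compose2[OF continuous_on_prod_map _ subset_UNIV]) (intro continuous_intros)
  fix a c assume a: "a \<in> A" and c: "c \<in> C"
  obtain b where b: "b \<in> B" "q \<in> chart_dom b"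
    using chart_around[OF B] by blast
  let ?S = "coords a ` (chart_dom a \<inter> (\<lambda>x. \<Phi> (x, q)) -` chart_dom c)"
  have o: "open ?S"
    using open_coords_image[OF A a] cont open_chart_dom[OF C c] open_vimage by blast
  have "smooth_on ?S (\<lambda>y. coords c (\<Phi> (param a (fst (y, coords b q)), param b (snd (y, coords b q)))))"
    by (rule smooth_on_compose[OF o open_prod_chart_dom[OF a b(1) open_chart_dom[OF C c]] _
          smooth_on_Pair[OF o smooth_on_ident smooth_on_const] smooth_on_prod_chart[OF a b(1) c]])
      (use b(2) in \<open>auto simp: prod_chart_dom_def param_coords[OF A a] param_coords[OF B b(1)]\<close>)
  then show "smooth_on ?S (\<lambda>y. coords c (\<Phi> (param a y, q)))"
    by (simp add: param_coords[OF B b])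
qed

lemma smooth_map_prod_slice2: "smooth_map B C (\<lambda>q. \<Phi> (x, q))"
  unfolding smooth_map_def o_def
proof (intro conjI ballI)
  show cont: "continuous_on UNIV (\<lambda>q. \<Phi> (x, q))"
    by (rule continuous_on_compose2[OF continuous_on_prod_map _ subset_UNIV]) (intro continuous_intros)
  fix b c assume b: "b \<in> B" and c: "c \<in> C"
  obtain a where a: "a \<in> A" "x \<in> chart_dom a"
    using chart_around[OF A] by blast
  let ?S = "coords b ` (chart_dom b \<inter> (\<lambda>q. \<Phi> (x, q)) -` chart_dom c)"
  have o: "open ?S"
    using open_coords_image[OF B b] cont open_chart_dom[OF C c] open_vimage by blast
  have "smooth_on ?S (\<lambda>z. coords c (\<Phi> (param a (fst (coords a x, z)), param b (snd (coords a x, z)))))"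
    by (rule smooth_on_compose[OF o open_prod_chart_dom[OF a(1) b open_chart_dom[OF C c]] _
          smooth_on_Pair[OF o smooth_on_const smooth_on_ident] smooth_on_prod_chart[OF a(1) b c]])
      (use a(2) in \<open>auto simp: prod_chart_dom_def param_coords[OF A a(1)] param_coords[OF B b]\<close>)
  then show "smooth_on ?S (\<lambda>z. coords c (\<Phi> (x, param b z)))"
    by (simp add: param_coords[OF A a])
qed

end


section \<open>Bilinear tensors and distributions\<close>

lemma
  assumes "smooth_tensor2 A h" "u \<in> tangent_space A p" "v \<in> tangent_space A p" "w \<in> tangent_space A p"
  shows tensor2_linear_left: "h p (\<lambda>f. r * u f + s * v f) w = r * h p u w + s * h p v w"
    and tensor2_linear_right: "h p w (\<lambda>f. r * u f + s * v f) = r * h p w u + s * h p w v"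
  using assms unfolding smooth_tensor2_def by blast+

lemma
  assumes A: "smooth_atlas A" and h: "smooth_tensor2 A h"
    and v: "v \<in> tangent_space A p" and w: "\<And>i. i \<in> I \<Longrightarrow> w i \<in> tangent_space A p"
  shows tensor2_sum_left: "h p (\<lambda>f. \<Sum>i\<in>I. r i * w i f) v = (\<Sum>i\<in>I. r i * h p (w i) v)"
    and tensor2_sum_right: "h p v (\<lambda>f. \<Sum>i\<in>I. r i * w i f) = (\<Sum>i\<in>I. r i * h p v (w i))"
proof -
  note lin = tensor2_linear_left[OF h _ _ v] tensor2_linear_right[OF h _ _ v]
  have zero: "h p (\<lambda>_. 0) v = 0 \<and> h p v (\<lambda>_. 0) = 0"
    using lin(1)[OF v v, of 0 0] lin(2)[OF v v, of 0 0] by simp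
  have "h p (\<lambda>f. \<Sum>i\<in>I. r i * w i f) v = (\<Sum>i\<in>I. r i * h p (w i) v) \<and>
      h p v (\<lambda>f. \<Sum>i\<in>I. r i * w i f) = (\<Sum>i\<in>I. r i * h p v (w i))"
    using w
  proof (induction I rule: infinite_finite_induct)
    case (insert j I)
    then show ?case
      using lin[of "w j" "\<lambda>f. \<Sum>i\<in>I. r i * w i f" "r j" 1] tangent_space_sum[OF A, of I w p r] by simp
  qed (simp_all add: zero)
  then show "h p (\<lambda>f. \<Sum>i\<in>I. r i * w i f) v = (\<Sum>i\<in>I. r i * h p (w i) v)"
    "h p v (\<lambda>f. \<Sum>i\<in>I. r i * w i f) = (\<Sum>i\<in>I. r i * h p v (w i))" by auto
qed

lemma
  assumes "smooth_atlas A" "smooth_tensor2 A h" "v \<in> tangent_space A p"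
    and "\<And>i. w i \<in> tangent_space A p"
  shows tensor2_lincomb_left: "h p (lincomb r w) v = (\<Sum>i\<in>UNIV. r i * h p (w i) v)"
    and tensor2_lincomb_right: "h p v (lincomb r w) = (\<Sum>i\<in>UNIV. r i * h p v (w i))"
  unfolding lincomb_def by (rule tensor2_sum_left[OF assms(1-3)] tensor2_sum_right[OF assms(1-3)]; rule assms(4))+

lemma smooth_distribution_in_tangent_space:
  assumes A: "smooth_atlas A" and D: "smooth_distribution A TYPE('m::finite) D" and "v \<in> D p"
  shows "v \<in> tangent_space A p"
proof -
  obtain S and Y :: "'m \<Rightarrow> _" where "p \<in> S" "\<forall>a. smooth_vfield_on A S (Y a)" "tvec_basis (\<lambda>a. Y a p) (D p)"
    using D unfolding smooth_distribution_def by blast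
  moreover from this have "Y a p \<in> tangent_space A p" for a
    by (blast intro: smooth_vfield_onD(2))
  moreover from calculation obtain r where "v = lincomb r (\<lambda>a. Y a p)"
    using assms(3) unfolding tvec_basis_def by blast
  ultimately show ?thesis
    using tangent_space_lincomb[OF A, of "\<lambda>a. Y a p" p r] by simp
qed

text \<open>That \<open>D p\<close> is a linear subspace is not part of the definition; it follows
  because \<open>D p\<close> is the span of a local frame.\<close>

lemma smooth_distribution_sum:
  assumes D: "smooth_distribution A TYPE('m::finite) D" and w: "\<And>i. i \<in> I \<Longrightarrow> w i \<in> D p"
  shows "(\<lambda>f. \<Sum>i\<in>I. r i * w i f) \<in> D p"
proof -
  obtain Y :: "'m \<Rightarrow> _" where Y: "tvec_basis (\<lambda>a. Y a p) (D p)"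
    using D unfolding smooth_distribution_def by blast
  then have "\<exists>s. w i = lincomb s (\<lambda>a. Y a p)" if "i \<in> I" for i
    using w[OF that] unfolding tvec_basis_def by blast
  then obtain s where s: "\<And>i. i \<in> I \<Longrightarrow> w i = lincomb (s i) (\<lambda>a. Y a p)"
    by metis
  have "(\<Sum>i\<in>I. r i * w i f) = lincomb (\<lambda>a. \<Sum>i\<in>I. r i * s i a) (\<lambda>a. Y a p) f" for f
    using s by (simp add: lincomb_def sum_distrib_left sum_distrib_right mult.assoc)
      (rule sum.swap)
  then show ?thesis
    using Y unfolding tvec_basis_def by blast
qed


section \<open>Infinitesimal generators and invariant fields\<close>

lemma smooth_on_partial_derivatives:
  assumes "smooth_on \<Omega> H" "(y, z) \<in> \<Omega>"
  shows "((\<lambda>y. H (y, z)) has_derivative (\<lambda>u. frechet_derivative H (at (y, z)) (u, 0))) (at y)"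
    and "((\<lambda>z. H (y, z)) has_derivative (\<lambda>e. frechet_derivative H (at (y, z)) (0, e))) (at z)"
proof -
  have H: "(H has_derivative frechet_derivative H (at (y, z))) (at (y, z))"
    by (rule smooth_on_has_derivative[OF assms])
  have "((\<lambda>y. (y, z)) has_derivative (\<lambda>u. (u, 0))) (at y)" "((\<lambda>z. (y, z)) has_derivative (\<lambda>e. (0, e))) (at z)"
    by (auto intro!: derivative_eq_intros)
  from this[THEN diff_chain_at, of H] H
  show "((\<lambda>y. H (y, z)) has_derivative (\<lambda>u. frechet_derivative H (at (y, z)) (u, 0))) (at y)"
    "((\<lambda>z. H (y, z)) has_derivative (\<lambda>e. frechet_derivative H (at (y, z)) (0, e))) (at z)"
    by (auto simp: o_def)
qed

locale smooth_action =
  fixes AQ :: "('q::{t2_space, second_countable_topology}, 'e::euclidean_space) atlas"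
    and AG :: "('g::{t2_space, second_countable_topology}, 'f::euclidean_space) atlas"
    and G :: "'g monoid" and act :: "'g \<Rightarrow> 'q \<Rightarrow> 'q"
  assumes AQ: "smooth_atlas AQ" and AG: "smooth_atlas AG"
    and action: "group_action G UNIV act"
    and smooth_act: "smooth_map (prod_atlas AG AQ) AQ (\<lambda>(x, q). act x q)"
begin

lemma act_one: "act \<one>\<^bsub>G\<^esub> q = q"
  using group_action.id_eq_one[OF action] by (metis UNIV_I restrict_apply')

lemmas act_slice1 = smooth_map_prod_slice1[OF AG AQ AQ smooth_act, unfolded prod.case]
lemmas act_slice2 = smooth_map_prod_slice2[OF AG AQ AQ smooth_act, unfolded prod.case]
lemmas act_pullback = smooth_on_prod_pullback[OF AG AQ AQ smooth_act, unfolded prod.case]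
lemmas open_act_dom = open_prod_chart_dom[OF AG AQ AQ smooth_act]

text \<open>The function \<open>(x, q) \<mapsto> f (act x q)\<close> in coordinates. Its derivative
  in the first slot at the identity gives a generator, and its derivative in the second slot gives a
  field on the manifold acted upon.\<close>

abbreviation act_chart :: "('g, 'f) chart \<Rightarrow> ('q, 'e) chart \<Rightarrow> ('q \<Rightarrow> real) \<Rightarrow> 'f \<times> 'e \<Rightarrow> real" where
  "act_chart a b f \<equiv> \<lambda>w. f (act (param a (fst w)) (param b (snd w)))"

abbreviation act_chart_dom :: "('g, 'f) chart \<Rightarrow> ('q, 'e) chart \<Rightarrow> 'q set \<Rightarrow> ('f \<times> 'e) set" where
  "act_chart_dom a b \<equiv> prod_chart_dom a b (\<lambda>(x, q). act x q)"

lemma mem_act_chart_dom: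
  "(y, z) \<in> act_chart_dom a b S \<longleftrightarrow> y \<in> coords a ` chart_dom a \<and> z \<in> coords b ` chart_dom b \<and>
     act (param a y) (param b z) \<in> S"
  by (auto simp: prod_chart_dom_def)

lemma generator_apply:
  "smooth_fun_at AQ q f \<Longrightarrow> infinitesimal_generator AQ G act \<xi> q f = \<xi> (\<lambda>x. f (act x q))"
  by (simp add: infinitesimal_generator_def tangent_map_def act_one o_def)

lemma generator_in_tangent_space:
  "\<xi> \<in> tangent_space AG \<one>\<^bsub>G\<^esub> \<Longrightarrow> infinitesimal_generator AQ G act \<xi> q \<in> tangent_space AQ q"
  using tangent_map_in_tangent_space[OF AG AQ act_slice1[of q]] act_one[of q]
  by (metis infinitesimal_generator_def)

text \<open>Along the orbit the function is constant, and derivations kill constants. The default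
  value 0 covers an \<open>f\<close> that is not smooth near \<open>q\<close>, so no regularity has
  to be assumed.\<close>

lemma generator_invariant_fun:
  assumes \<xi>: "\<xi> \<in> tangent_space AG \<one>\<^bsub>G\<^esub>" and "\<And>x. f (act x q) = f q"
  shows "infinitesimal_generator AQ G act \<xi> q f = 0"
  using tangent_vector_const[OF AG \<xi>] tangent_vector_not_smooth[OF generator_in_tangent_space[OF \<xi>]]
  by (cases "smooth_fun_at AQ q f") (simp_all add: generator_apply assms(2))

text \<open>The identity acts trivially, so the point with coordinates
  \<open>(coords a \<one>, z)\<close> is sent to \<open>param b z\<close>. The generator is there
  the partial derivative in the group variable.\<close>

lemma generator_chart:
  assumes a: "a \<in> AG" "\<one>\<^bsub>G\<^esub> \<in> chart_dom a" and b: "b \<in> AQ" and f: "smooth_fun_on AQ S f"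
    and z: "z \<in> coords b ` (chart_dom b \<inter> S)"
  shows "infinitesimal_generator AQ G act (chart_deriv AG a \<one>\<^bsub>G\<^esub> u) (param b z) f =
    frechet_derivative (act_chart a b f) (at (coords a \<one>\<^bsub>G\<^esub>, z)) (u, 0)"
    and "(coords a \<one>\<^bsub>G\<^esub>, z) \<in> act_chart_dom a b S"
proof -
  have S: "param b z \<in> S" "z \<in> coords b ` chart_dom b"
    using z mem_coords_image_iff[OF AQ b] by blast+
  then show mem: "(coords a \<one>\<^bsub>G\<^esub>, z) \<in> act_chart_dom a b S"
    using a by (simp add: mem_act_chart_dom param_coords[OF AG a] act_one)
  have sm: "smooth_fun_at AG \<one>\<^bsub>G\<^esub> (\<lambda>x. f (act x (param b z)))"
    using smooth_map_pullback_at[OF AG AQ act_slice1, of "\<one>\<^bsub>G\<^esub>" "param b z" f]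
      smooth_fun_atI[OF f S(1)] by (simp add: act_one o_def)
  show "infinitesimal_generator AQ G act (chart_deriv AG a \<one>\<^bsub>G\<^esub> u) (param b z) f =
      frechet_derivative (act_chart a b f) (at (coords a \<one>\<^bsub>G\<^esub>, z)) (u, 0)"
    unfolding generator_apply[OF smooth_fun_atI[OF f S(1)]]
    using smooth_on_partial_derivatives(1)[OF act_pullback[OF a(1) b f] mem]
    by (intro chart_deriv_eqI[OF AG a sm]) simp
qed

text \<open>Freezing the group variable at the identity in a first derivative of the smooth local
  expression leaves a smooth function of \<open>z\<close>.\<close>

lemma smooth_vfield_generator:
  assumes \<xi>: "\<xi> \<in> tangent_space AG \<one>\<^bsub>G\<^esub>"
  shows "smooth_vfield_on AQ UNIV (infinitesimal_generator AQ G act \<xi>)"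
  unfolding smooth_vfield_on_def
proof (intro conjI ballI allI impI open_UNIV generator_in_tangent_space[OF \<xi>])
  fix W f assume f: "smooth_fun_on AQ W f"
  obtain a where a: "a \<in> AG" "\<one>\<^bsub>G\<^esub> \<in> chart_dom a"
    using chart_around[OF AG] by blast
  obtain u where u: "\<xi> = chart_deriv AG a \<one>\<^bsub>G\<^esub> u"
    using tangent_vector_chart[OF AG \<xi> a] .
  show "smooth_fun_on AQ W (\<lambda>p. infinitesimal_generator AQ G act \<xi> p f)"
  proof (rule smooth_fun_on_local[OF AQ smooth_fun_onD(1)[OF f]])
    fix p assume p: "p \<in> W"
    obtain b where b: "b \<in> AQ" "p \<in> chart_dom b"
      using chart_around[OF AQ] by blast
    let ?T = "chart_dom b \<inter> W"
    note o = open_coords_image[OF AQ b(1) smooth_fun_onD(1)[OF f]]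
    have "smooth_on (coords b ` ?T)
        (\<lambda>z. frechet_derivative (act_chart a b f) (at (coords a \<one>\<^bsub>G\<^esub>, z)) (u, 0))"
      by (rule smooth_on_compose[OF o open_act_dom[OF a(1) b(1) smooth_fun_onD(1)[OF f]] _
            smooth_on_Pair[OF o smooth_on_const smooth_on_ident]
            smooth_on_frechet_derivative[OF act_pullback[OF a(1) b(1) f]]])
        (use generator_chart(2)[OF a b(1) f] in blast)
    then have "smooth_on (coords b ` ?T) (\<lambda>z. infinitesimal_generator AQ G act \<xi> (param b z) f)"
      by (rule smooth_on_cong[OF o, rotated]) (simp only: u generator_chart(1)[OF a b(1) f])
    then have "smooth_fun_on AQ ?T (\<lambda>p. infinitesimal_generator AQ G act \<xi> p f)"
      using open_chart_dom[OF AQ b(1)] smooth_fun_onD(1)[OF f] by (intro smooth_fun_onI[OF AQ b(1)]) auto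
    then show "\<exists>T. p \<in> T \<and> smooth_fun_on AQ T (\<lambda>p. infinitesimal_generator AQ G act \<xi> p f)"
      using p b(2) by (intro exI[of _ ?T]) simp
  qed
qed

text \<open>In a product chart the two iterated derivatives are the mixed second partial derivatives of
  \<open>(x, q) \<mapsto> f (act x q)\<close>.\<close>

lemma lie_bracket_generator:
  assumes \<xi>: "\<xi> \<in> tangent_space AG \<one>\<^bsub>G\<^esub>" and X: "smooth_vfield_on AQ S X" and p: "p \<in> S"
    and inv: "\<And>x. X (act x p) = tangent_map AQ (act x) p (X p)"
  shows "lie_bracket AQ X (infinitesimal_generator AQ G act \<xi>) p = (\<lambda>_. 0)"
proof
  fix f
  let ?V = "infinitesimal_generator AQ G act \<xi>"
  show "lie_bracket AQ X ?V p f = 0"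
  proof (cases "smooth_fun_at AQ p f")
    case True
    then obtain W where W: "p \<in> W" "smooth_fun_on AQ W f"
      unfolding smooth_fun_at_def by blast
    obtain a where a: "a \<in> AG" "\<one>\<^bsub>G\<^esub> \<in> chart_dom a"
      using chart_around[OF AG] by blast
    obtain u where u: "\<xi> = chart_deriv AG a \<one>\<^bsub>G\<^esub> u"
      using tangent_vector_chart[OF AG \<xi> a] .
    obtain b where b: "b \<in> AQ" "p \<in> chart_dom b"
      using chart_around[OF AQ] by blast
    obtain e where e: "X p = chart_deriv AQ b p e"
      using tangent_vector_chart[OF AQ smooth_vfield_onD(2)[OF X p] b] .
    define H where "H = act_chart a b f"
    define \<Omega> where "\<Omega> = act_chart_dom a b W"
    define y0 z0 where "y0 = coords a \<one>\<^bsub>G\<^esub>" and "z0 = coords b p"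
    have H: "smooth_on \<Omega> H" and \<Omega>: "open \<Omega>"
      unfolding H_def \<Omega>_def using act_pullback[OF a(1) b(1) W(2)]
        open_act_dom[OF a(1) b(1) smooth_fun_onD(1)[OF W(2)]] .
    have z0: "z0 \<in> coords b ` (chart_dom b \<inter> W)" "param b z0 = p" and y0: "param a y0 = \<one>\<^bsub>G\<^esub>"
      unfolding z0_def y0_def using b W(1) by (auto simp: param_coords[OF AQ b] param_coords[OF AG a])
    have yz: "(y0, z0) \<in> \<Omega>"
      unfolding \<Omega>_def y0_def by (rule generator_chart(2)[OF a b(1) W(2) z0(1)])
    have "X p (\<lambda>q. ?V q f) = frechet_derivative (\<lambda>w. frechet_derivative H (at w) (u, 0)) (at (y0, z0)) (0, e)"
      unfolding e
    proof (rule chart_deriv_eqI[OF AQ b])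
      show "smooth_fun_at AQ p (\<lambda>q. ?V q f)"
        by (rule smooth_vfield_on_apply_smooth_at[OF smooth_vfield_generator[OF \<xi>] True UNIV_I])
      have "((\<lambda>z. frechet_derivative H (at (y0, z)) (u, 0)) has_derivative
          (\<lambda>e. frechet_derivative (\<lambda>w. frechet_derivative H (at w) (u, 0)) (at (y0, z0)) (0, e))) (at z0)"
        by (rule smooth_on_partial_derivatives(2)[OF smooth_on_frechet_derivative[OF H] yz])
      then show "((\<lambda>z. ?V (param b z) f) has_derivative
          (\<lambda>e. frechet_derivative (\<lambda>w. frechet_derivative H (at w) (u, 0)) (at (y0, z0)) (0, e)))
          (at (coords b p))"
        unfolding z0_def[symmetric] H_def y0_def
        by (rule has_derivative_transform_within_open
            [OF _ open_coords_image[OF AQ b(1) smooth_fun_onD(1)[OF W(2)]] z0(1)])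
          (simp only: u generator_chart(1)[OF a b(1) W(2)])
    qed
    moreover have "?V p (\<lambda>q. X q f) =
        frechet_derivative (\<lambda>w. frechet_derivative H (at w) (0, e)) (at (y0, z0)) (u, 0)"
    proof -
      have Xf: "smooth_fun_at AQ p (\<lambda>q. X q f)"
        by (rule smooth_vfield_on_apply_smooth_at[OF X True p])
      have pre: "open {y. (y, z0) \<in> \<Omega>}"
        using open_vimage[OF \<Omega>, of "\<lambda>y. (y, z0)"] by (simp add: vimage_def continuous_intros)
      \<comment> \<open>Here invariance enters: the coordinate vector \<open>e\<close> of
        \<open>X p\<close> is fixed while \<open>y\<close> varies, and the differential of
        \<open>act (param a y)\<close> carries \<open>X p\<close> to \<open>X\<close> at the
        translated point. Hence the partial derivative along \<open>e\<close> equals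
        \<open>X f\<close> along the orbit of \<open>p\<close>.\<close>
      have Xact: "frechet_derivative H (at (y, z0)) (0, e) = X (act (param a y) p) f"
        if "y \<in> {y. (y, z0) \<in> \<Omega>}" for y
      proof -
        have "act (param a y) p \<in> W"
          using that z0(2) by (simp add: \<Omega>_def mem_act_chart_dom)
        then have f: "smooth_fun_at AQ (act (param a y) p) f"
          by (rule smooth_fun_atI[OF W(2)])
        have "smooth_fun_at AQ p (f \<circ> act (param a y))"
          by (rule smooth_map_pullback_at[OF AQ AQ act_slice2 f])
        moreover have "((\<lambda>z. (f \<circ> act (param a y)) (param b z)) has_derivative
            (\<lambda>e. frechet_derivative H (at (y, z0)) (0, e))) (at (coords b p))"
          using smooth_on_partial_derivatives(2)[OF H, of y z0] that
          by (simp add: H_def z0_def)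
        ultimately show ?thesis
          using f e by (simp add: inv tangent_map_def chart_deriv_eqI[OF AQ b])
      qed
      show ?thesis
        unfolding generator_apply[OF Xf] unfolding u
      proof (rule chart_deriv_eqI[OF AG a])
        show "smooth_fun_at AG \<one>\<^bsub>G\<^esub> (\<lambda>x. X (act x p) f)"
          using smooth_map_pullback_at[OF AG AQ act_slice1, of "\<one>\<^bsub>G\<^esub>" p "\<lambda>q. X q f"] Xf
          by (simp add: act_one o_def)
        have "((\<lambda>y. frechet_derivative H (at (y, z0)) (0, e)) has_derivative
            (\<lambda>u. frechet_derivative (\<lambda>w. frechet_derivative H (at w) (0, e)) (at (y0, z0)) (u, 0))) (at y0)"
          by (rule smooth_on_partial_derivatives(1)[OF smooth_on_frechet_derivative[OF H] yz])
        then show "((\<lambda>y. X (act (param a y) p) f) has_derivative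
            (\<lambda>u. frechet_derivative (\<lambda>w. frechet_derivative H (at w) (0, e)) (at (y0, z0)) (u, 0)))
            (at (coords a \<one>\<^bsub>G\<^esub>))"
          unfolding y0_def[symmetric]
          by (rule has_derivative_transform_within_open[OF _ pre]) (use yz Xact in auto)
      qed
    qed
    ultimately show ?thesis
      using smooth_on_schwarz[OF \<Omega> H yz, of "(u, 0)" "(0, e)"] True by (simp add: lie_bracket_def)
  qed (simp add: lie_bracket_def)
qed

end


section \<open>The adapted frame of a Chaplygin system\<close>

lemma lincomb_frame:
  fixes X :: "'m::finite \<Rightarrow> 'q vfield" and Y :: "'l::finite \<Rightarrow> 'q vfield"
  shows "lincomb r (\<lambda>\<gamma>. frame X Y \<gamma> p) f =
    (\<Sum>a\<in>UNIV. r (Inl a) * X a p f) + (\<Sum>i\<in>UNIV. r (Inr i) * Y i p f)"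
proof -
  have "(\<Sum>\<gamma>\<in>UNIV. r \<gamma> * frame X Y \<gamma> p f) = (\<Sum>\<gamma>\<in>UNIV <+> UNIV. r \<gamma> * frame X Y \<gamma> p f)"
    by (simp only: UNIV_Plus_UNIV)
  also have "\<dots> = (\<Sum>a\<in>UNIV. r (Inl a) * frame X Y (Inl a) p f) + (\<Sum>i\<in>UNIV. r (Inr i) * frame X Y (Inr i) p f)"
    by (simp add: sum.Plus del: UNIV_Plus_UNIV)
  finally show ?thesis
    by (simp add: lincomb_def frame_def)
qed

lemma matrix_inv_left:
  fixes M :: "real ^ 'm ^ 'm"
  assumes "invertible M"
  shows "matrix_inv M ** M = mat 1"
  using assms unfolding invertible_def matrix_inv_def by (rule someI2_ex) blast

lemma matrix_inv_left_sum:
  fixes M :: "real ^ 'm ^ 'm"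
  assumes "invertible M"
  shows "(\<Sum>b\<in>UNIV. matrix_inv M $ a $ b * M $ b $ c) = (if a = c then 1 else 0)"
proof -
  have "(matrix_inv M ** M) $ a $ c = (mat 1 :: real ^ 'm ^ 'm) $ a $ c"
    using matrix_inv_left[OF assms] by simp
  then show ?thesis
    by (simp add: matrix_matrix_mult_def mat_def)
qed

lemma levi_civitaD:
  assumes "levi_civita A g nabla" "smooth_vfield_on A S X" "smooth_vfield_on A S Y"
  shows "smooth_vfield_on A S (nabla X Y)"
    and "p \<in> S \<Longrightarrow> lie_bracket A X Y p = (\<lambda>f. nabla X Y p f - nabla Y X p f)"
    and "smooth_vfield_on A S Z \<Longrightarrow> p \<in> S \<Longrightarrow>
      X p (\<lambda>q. g q (Y q) (Z q)) = g p (nabla X Y p) (Z p) + g p (Y p) (nabla X Z p)"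
proof -
  \<comment> \<open>The axioms are bundled under one quantifier that also ranges over a smooth
    function. The identities extracted here do not mention it, so a constant instantiates
    it.\<close>
  have h: "smooth_fun_on A S (\<lambda>_. 0)"
    using smooth_vfield_onD(1)[OF assms(2)] by simp
  note * = assms(1)[unfolded levi_civita_def, rule_format, OF assms(2,3) _ h]
  show "smooth_vfield_on A S (nabla X Y)"
    and "p \<in> S \<Longrightarrow> lie_bracket A X Y p = (\<lambda>f. nabla X Y p f - nabla Y X p f)"
    using *[OF assms(3)] by simp_all
  show "X p (\<lambda>q. g q (Y q) (Z q)) = g p (nabla X Y p) (Z p) + g p (Y p) (nabla X Z p)"
    if "smooth_vfield_on A S Z" "p \<in> S"
    using *[OF that(1)] that(2) by simp
qed

locale chaplygin_frame = smooth_action AQ AG G act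
  for AQ :: "('q::{t2_space, second_countable_topology}, 'e::euclidean_space) atlas"
    and AG :: "('g::{t2_space, second_countable_topology}, 'f::euclidean_space) atlas"
    and G :: "'g monoid" and act :: "'g \<Rightarrow> 'q \<Rightarrow> 'q" +
  fixes AB :: "('b::{t2_space, second_countable_topology}, real ^ 'm) atlas"
    and \<pi> :: "'q \<Rightarrow> 'b" and g :: "'q tensor2" and D :: "'q \<Rightarrow> 'q tvec set"
    and c :: "('b, real ^ 'm) chart" and X :: "'m \<Rightarrow> 'q vfield"
    and \<xi> :: "'l::finite \<Rightarrow> 'g tvec"
  assumes carrier: "carrier G = UNIV"
    and quotient: "orbit_bundle G AQ act AB \<pi>"
    and metric: "riemannian_metric AQ g" "invariant_tensor2 AQ act g"
    and connection: "principal_connection AQ act AB \<pi> D"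
    and chart: "c \<in> AB"
    and lift: "\<And>a. horizontal_lift_on AQ AB \<pi> D (chart_dom c) (coord_vfield AB c a) (X a)"
    and \<xi>: "\<And>i. \<xi> i \<in> tangent_space AG \<one>\<^bsub>G\<^esub>"
begin

section \<open>Invariant horizontal lifts and infinitesimal generators\<close>

definition U where "U = \<pi> -` chart_dom c"
definition V where "V i = infinitesimal_generator AQ G act (\<xi> i)"

abbreviation "K \<equiv> K_coeff g X V"
abbreviation "Y \<equiv> orth_field g X V"

lemma AB: "smooth_atlas AB" and smooth_\<pi>: "smooth_map AQ AB \<pi>"
  using quotient unfolding orbit_bundle_def by blast+

lemma \<pi>_act: "\<pi> (act x p) = \<pi> p"
proof -
  have "act x p \<in> orbit G act p"
    using carrier unfolding orbit_def by auto
  then show ?thesis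
    using quotient unfolding orbit_bundle_def by metis
qed

lemma act_U: "act x p \<in> U \<longleftrightarrow> p \<in> U"
  by (simp add: U_def \<pi>_act)

lemma distribution: "smooth_distribution AQ TYPE('m) D"
  using connection unfolding principal_connection_def by blast

text \<open>This is \<open>D \<inter> ker T\<pi> = 0\<close> in usable form: by linearity a
  horizontal vector is determined by its projection.\<close>

lemma horizontal_vertical_zero:
  "v \<in> D p \<Longrightarrow> tangent_map AB \<pi> p v = (\<lambda>_. 0) \<Longrightarrow> v = (\<lambda>_. 0)"
  using connection smooth_distribution_in_tangent_space[OF AQ distribution, of v p]
  unfolding principal_connection_def vertical_def by blast

lemma smooth_X: "smooth_vfield_on AQ U (X a)"
  using lift unfolding horizontal_lift_on_def U_def by blast

lemmas open_U = smooth_vfield_onD(1)[OF smooth_X]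

lemma
  assumes "p \<in> U"
  shows X_horizontal: "X a p \<in> D p"
    and tangent_map_X: "tangent_map AB \<pi> p (X a p) = coord_vfield AB c a (\<pi> p)"
    and X_tangent: "X a p \<in> tangent_space AQ p"
  using assms lift smooth_vfield_onD(2)[OF smooth_X] unfolding horizontal_lift_on_def U_def by auto

lemma X_pullback:
  assumes "p \<in> U" "smooth_fun_at AB (\<pi> p) f"
  shows "X a p (f \<circ> \<pi>) = coord_vfield AB c a (\<pi> p) f"
  using fun_cong[OF tangent_map_X[OF assms(1)], of a f] assms(2) by (simp add: tangent_map_def)

text \<open>Horizontal lifts are unique. Both sides are horizontal at \<open>act x p\<close>, the
  right one by invariance of \<open>D\<close>, and both project to the same coordinate vector
  because \<open>\<pi>\<close> is constant on orbits.\<close>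

lemma X_invariant:
  assumes p: "p \<in> U"
  shows "X a (act x p) = tangent_map AQ (act x) p (X a p)"
proof -
  let ?q = "act x p"
  have q: "?q \<in> U"
    using p by (simp add: act_U)
  \<comment> \<open>Indexing the two vectors by \<open>bool\<close> presents their difference as a
    sum with coefficients 1 and -1, so that \<open>smooth_distribution_sum\<close> shows it to be
    horizontal.\<close>
  define w where "w b = (if b then X a ?q else tangent_map AQ (act x) p (X a p))" for b
  define d where "d = (\<lambda>f. \<Sum>b\<in>UNIV. (if b then 1 else - 1) * w b f)"
  have "tangent_map AQ (act x) p ` D p = D ?q"
    using connection unfolding principal_connection_def invariant_distribution_def by blast
  then have "w b \<in> D ?q" for b
    using X_horizontal[OF p] X_horizontal[OF q] unfolding w_def by auto
  then have "d \<in> D ?q"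
    unfolding d_def by (intro smooth_distribution_sum[OF distribution])
  moreover have "tangent_map AB \<pi> ?q d f = 0" for f
  proof (cases "smooth_fun_at AB (\<pi> p) f")
    case True
    then have "smooth_fun_at AQ ?q (f \<circ> \<pi>)"
      by (intro smooth_map_pullback_at[OF AQ AB smooth_\<pi>]) (simp add: \<pi>_act)
    moreover have "f \<circ> \<pi> \<circ> act x = f \<circ> \<pi>"
      by (auto simp: \<pi>_act)
    ultimately show ?thesis
      using X_pullback[OF p True] X_pullback[OF q] True
      by (simp add: tangent_map_def d_def w_def UNIV_bool \<pi>_act)
  qed (simp add: tangent_map_def \<pi>_act)
  ultimately have "d = (\<lambda>_. 0)"
    using horizontal_vertical_zero by blast
  then have "d f = 0" for f
    by simp
  then have "X a ?q f - tangent_map AQ (act x) p (X a p) f = 0" for f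
    by (simp add: d_def w_def UNIV_bool)
  then show ?thesis
    by (intro ext) simp
qed

lemma V_tangent: "V i p \<in> tangent_space AQ p"
  unfolding V_def by (rule generator_in_tangent_space[OF \<xi>])

lemma smooth_V: "smooth_vfield_on AQ U (V i)"
  unfolding V_def using smooth_vfield_on_subset[OF smooth_vfield_generator[OF \<xi>] open_U] by blast

lemma V_pullback: "V i p (f \<circ> \<pi>) = 0"
  unfolding V_def by (rule generator_invariant_fun[OF \<xi>]) (simp add: \<pi>_act)

lemma lie_bracket_X_V: "p \<in> U \<Longrightarrow> lie_bracket AQ (X a) (V i) p = (\<lambda>_. 0)"
  unfolding V_def by (rule lie_bracket_generator[OF \<xi> smooth_X]) (simp_all add: X_invariant)

text \<open>Invariance of both \<open>g\<close> and the lifts makes the Gram entries constant along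
  orbits.\<close>

lemma V_gram: "p \<in> U \<Longrightarrow> V i p (\<lambda>q. g q (X a q) (X b q)) = 0"
  unfolding V_def using metric(2) X_tangent[of p]
  by (intro generator_invariant_fun[OF \<xi>]) (simp add: X_invariant invariant_tensor2_def)

lemma g_tensor: "smooth_tensor2 AQ g"
  using metric(1) unfolding riemannian_metric_def symmetric_tensor2_def by blast

lemma g_sym: "u \<in> tangent_space AQ p \<Longrightarrow> v \<in> tangent_space AQ p \<Longrightarrow> g p u v = g p v u"
  using metric(1) unfolding riemannian_metric_def symmetric_tensor2_def by blast

text \<open>\<open>Y k\<close> and \<open>V k\<close> differ by a horizontal vector, so the
  hypothesis makes the sum of the \<open>r k * V k\<close> horizontal. It is vertical as well, hence
  zero, and is then paired with \<open>X a\<close>. These pairings are, up to sign, the coefficients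
  of \<open>theta\<close>.\<close>

lemma vertical_part_zero:
  assumes p: "p \<in> U" and eq: "\<And>f. (\<Sum>k\<in>UNIV. r k * Y k p f) = (\<Sum>b\<in>UNIV. s b * X b p f)"
  shows "(\<Sum>k\<in>UNIV. r k * g p (X a p) (V k p)) = 0"
proof -
  let ?S = "\<lambda>f. \<Sum>k\<in>UNIV. r k * V k p f"
  have "?S f = (\<Sum>b\<in>UNIV. (s b - (\<Sum>k\<in>UNIV. r k * K b k p)) * X b p f)" for f
  proof -
    have "(\<Sum>k\<in>UNIV. r k * Y k p f) = ?S f + (\<Sum>k\<in>UNIV. \<Sum>b\<in>UNIV. r k * K b k p * X b p f)"
      by (simp add: orth_field_def algebra_simps sum.distrib sum_distrib_left)
    also have "(\<Sum>k\<in>UNIV. \<Sum>b\<in>UNIV. r k * K b k p * X b p f) =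
        (\<Sum>b\<in>UNIV. (\<Sum>k\<in>UNIV. r k * K b k p) * X b p f)"
      by (subst sum.swap) (simp add: sum_distrib_right)
    finally show ?thesis
      using eq[of f] by (simp add: left_diff_distrib sum_subtractf)
  qed
  then have "?S = (\<lambda>f. \<Sum>b\<in>UNIV. (s b - (\<Sum>k\<in>UNIV. r k * K b k p)) * X b p f)"
    by (rule ext)
  then have "?S \<in> D p"
    using smooth_distribution_sum[OF distribution, of UNIV "\<lambda>b. X b p" p] X_horizontal[OF p] by simp
  moreover have "tangent_map AB \<pi> p ?S = (\<lambda>_. 0)"
    unfolding tangent_map_def by (rule ext) (simp add: V_pullback)
  ultimately have "?S = (\<lambda>_. 0)"
    by (rule horizontal_vertical_zero)
  moreover have "g p (X a p) ?S = (\<Sum>k\<in>UNIV. r k * g p (X a p) (V k p))"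
    by (rule tensor2_sum_right[OF AQ g_tensor X_tangent[OF p] V_tangent])
  moreover have "g p (X a p) (\<lambda>_. 0) = 0"
    using tensor2_sum_right[OF AQ g_tensor X_tangent[OF p], where I = "{}"] by simp
  ultimately show ?thesis
    by simp
qed

text \<open>The pulled back coordinate functions of the base are dual to the lifts:
  \<open>X b\<close> applied to the \<open>a\<close>-th one is the Kronecker delta.\<close>

lemma X_independent:
  assumes p: "p \<in> U" and zero: "lincomb r (\<lambda>a. X a p) = (\<lambda>_. 0)"
  shows "r a = 0"
proof -
  have \<pi>p: "\<pi> p \<in> chart_dom c"
    using p by (simp add: U_def)
  let ?f = "\<lambda>q. coords c q $ a"
  note o = open_coords_chart_dom[OF AB chart] and d = open_chart_dom[OF AB chart]
  have "smooth_on (coords c ` chart_dom c) (\<lambda>y. y $ a)"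
    by (rule smooth_on_bounded_linear[OF o bounded_linear_vec_nth smooth_on_ident])
  then have "smooth_on (coords c ` chart_dom c) (\<lambda>y. ?f (param c y))"
    by (rule smooth_on_cong[OF o, rotated]) (simp add: coords_param[OF AB chart])
  then have f: "smooth_fun_at AB (\<pi> p) ?f"
    by (rule smooth_fun_atI[OF smooth_fun_onI[OF AB chart d order_refl] \<pi>p])
  have "((\<lambda>y. y $ a) has_derivative (\<lambda>u. u $ a)) (at (coords c (\<pi> p)))"
    by (rule bounded_linear_imp_has_derivative[OF bounded_linear_vec_nth])
  then have f': "((\<lambda>y. ?f (param c y)) has_derivative (\<lambda>u. u $ a)) (at (coords c (\<pi> p)))"
    by (rule has_derivative_transform_within_open[OF _ o]) (simp_all add: \<pi>p coords_param[OF AB chart])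
  have "r b * X b p (?f \<circ> \<pi>) = (if a = b then r b else 0)" for b
    using X_pullback[OF p f, of b] chart_deriv_eqI[OF AB chart \<pi>p f f', of "axis b 1"]
    by (simp add: coord_vfield_def axis_def)
  then have "lincomb r (\<lambda>a. X a p) (?f \<circ> \<pi>) = r a"
    by (simp add: lincomb_def)
  then show ?thesis
    using zero by simp
qed

text \<open>A kernel vector yields a combination of the \<open>X a\<close> that is orthogonal to all
  of them, hence to itself. Positivity makes it zero and independence makes its coefficients
  zero.\<close>

lemma invertible_gram:
  assumes p: "p \<in> U"
  shows "invertible (gram g X p)"
proof -
  have "x = 0" if x: "gram g X p *v x = 0" for x
  proof -
    let ?v = "lincomb (\<lambda>a. x $ a) (\<lambda>a. X a p)"
    have v: "?v \<in> tangent_space AQ p"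
      by (rule tangent_space_lincomb[OF AQ X_tangent[OF p]])
    have "g p (X a p) ?v = 0" for a
    proof -
      have "(gram g X p *v x) $ a = 0"
        using x by simp
      then show ?thesis
        using tensor2_lincomb_right[OF AQ g_tensor X_tangent[OF p, of a] X_tangent[OF p], of "\<lambda>a. x $ a"]
        by (simp add: matrix_vector_mult_def gram_def mult.commute)
    qed
    then have "g p ?v ?v = 0"
      using tensor2_lincomb_left[OF AQ g_tensor v X_tangent[OF p], of "\<lambda>a. x $ a"] by simp
    then have "?v = (\<lambda>_. 0)"
      using metric(1) v unfolding riemannian_metric_def by fastforce
    then show ?thesis
      using X_independent[OF p, of "\<lambda>a. x $ a"] by (simp add: vec_eq_iff)
  qed
  then show ?thesis
    by (simp add: invertible_left_inverse matrix_left_invertible_ker)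
qed

text \<open>The equation that characterises \<open>K\<close>. The sum in \<open>K_coeff\<close> runs
  over the first index of the inverse matrix, so symmetry of \<open>g\<close> is used before the
  left inverse identity applies.\<close>

lemma gram_K:
  assumes p: "p \<in> U"
  shows "(\<Sum>b\<in>UNIV. g p (X a p) (X b p) * K b i p) = - g p (X a p) (V i p)"
proof -
  have "(\<Sum>b\<in>UNIV. g p (X a p) (X b p) * K b i p) =
      - (\<Sum>d\<in>UNIV. \<Sum>b\<in>UNIV. matrix_inv (gram g X p) $ d $ b * gram g X p $ b $ a * g p (X d p) (V i p))"
    using g_sym[OF X_tangent[OF p] X_tangent[OF p]]
    by (subst sum.swap) (simp add: K_coeff_def gram_def sum_distrib_left sum_negf mult_ac)
  also have "\<dots> = - (\<Sum>d\<in>UNIV. (if d = a then 1 else 0) * g p (X d p) (V i p))"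
    by (simp only: matrix_inv_left_sum[OF invertible_gram[OF p]] flip: sum_distrib_right)
  also have "\<dots> = - g p (X a p) (V i p)"
    by (simp add: if_distrib[of "\<lambda>x. x * _"] cong: if_cong)
  finally show ?thesis .
qed

lemma Y_tangent:
  assumes p: "p \<in> U"
  shows "Y i p \<in> tangent_space AQ p"
proof -
  have "(\<lambda>f. 1 * V i p f + 1 * (\<Sum>b\<in>UNIV. K b i p * X b p f)) \<in> tangent_space AQ p"
    by (rule tangent_space_combination[OF AQ V_tangent tangent_space_sum[OF AQ X_tangent[OF p]]])
  then show ?thesis
    by (simp add: orth_field_def)
qed

lemma g_orth_field:
  assumes p: "p \<in> U" and u: "u \<in> tangent_space AQ p"
  shows "g p u (Y i p) = g p u (V i p) + (\<Sum>b\<in>UNIV. K b i p * g p u (X b p))"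
proof -
  let ?w = "\<lambda>f. \<Sum>b\<in>UNIV. K b i p * X b p f"
  have "?w \<in> tangent_space AQ p"
    by (rule tangent_space_sum[OF AQ X_tangent[OF p]])
  then have "g p u (\<lambda>f. 1 * V i p f + 1 * ?w f) = 1 * g p u (V i p) + 1 * g p u ?w"
    by (rule tensor2_linear_right[OF g_tensor V_tangent _ u])
  then show ?thesis
    unfolding orth_field_def using tensor2_sum_right[OF AQ g_tensor u X_tangent[OF p]] by simp
qed

lemma g_X_Y: "p \<in> U \<Longrightarrow> g p (X a p) (Y i p) = 0"
  using g_orth_field[OF _ X_tangent, of p a i] gram_K[of p a i] by (simp add: mult.commute)

lemma smooth_gram: "smooth_fun_on AQ U (\<lambda>p. g p (X a p) (X b p))"
  and smooth_mixed_gram: "smooth_fun_on AQ U (\<lambda>p. g p (X a p) (V i p))"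
  using g_tensor smooth_X smooth_V unfolding smooth_tensor2_def by blast+

text \<open>\<open>matrix_inv\<close> is defined by choice and reveals nothing about regularity.
  Cramer's rule for the system \<open>gram_K\<close> exhibits \<open>K\<close> as a quotient of
  determinants of smooth functions.\<close>

lemma smooth_K: "smooth_fun_on AQ U (K b i)"
proof -
  \<comment> \<open>Cramer's numerator: the Gram matrix with column \<open>b\<close> replaced by the
    right-hand side of \<open>gram_K\<close>.\<close>
  define M where "M p = (\<chi> a d. if d = b then - 1 * g p (X a p) (V i p) else gram g X p $ a $ d)" for p
  have eq: "det (M p) * inverse (det (gram g X p)) = K b i p" if p: "p \<in> U" for p
  proof -
    have "gram g X p *v (\<chi> b. K b i p) = (\<chi> a. - g p (X a p) (V i p))"
      using gram_K[OF p] by (simp add: matrix_vector_mult_def gram_def vec_eq_iff)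
    then have "K b i p = det (\<chi> a d. if d = b then - g p (X a p) (V i p) else gram g X p $ a $ d) / det (gram g X p)"
      using cramer[of "gram g X p" "\<chi> b. K b i p" "\<chi> a. - g p (X a p) (V i p)"] invertible_gram[OF p]
      by (simp add: invertible_det_nz vec_eq_iff cong: if_cong)
    then show ?thesis
      by (simp add: M_def divide_inverse cong: if_cong)
  qed
  have "smooth_fun_on AQ U (\<lambda>p. M p $ a $ d)" for a d
    using smooth_gram smooth_fun_on_mult[OF AQ smooth_fun_on_const[OF open_U] smooth_mixed_gram, of "- 1" a i]
    by (cases "d = b") (simp_all add: M_def gram_def)
  moreover have "smooth_fun_on AQ U (\<lambda>p. inverse (det (gram g X p)))"
    using smooth_gram invertible_gram
    by (intro smooth_fun_on_inverse[OF AQ smooth_fun_on_det[OF AQ open_U]])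
      (auto simp: gram_def invertible_det_nz)
  ultimately have "smooth_fun_on AQ U (\<lambda>p. det (M p) * inverse (det (gram g X p)))"
    by (intro smooth_fun_on_mult[OF AQ smooth_fun_on_det[OF AQ open_U]])
  then show ?thesis
    by (rule smooth_fun_on_cong[OF AQ]) (rule eq)
qed

text \<open>Expanding \<open>Y i\<close> by the Leibniz rule gives the bracket of \<open>V i\<close>
  with \<open>X a\<close>, which vanishes, the brackets of the lifts weighted by \<open>K\<close>,
  and derivatives of \<open>K\<close> along \<open>X a\<close>, which only multiply lifts.\<close>

lemma lie_bracket_Y_X:
  assumes p: "p \<in> U"
  shows "lie_bracket AQ (Y i) (X a) p f =
    - (\<Sum>b\<in>UNIV. K b i p * lie_bracket AQ (X a) (X b) p f) - (\<Sum>b\<in>UNIV. X a p (K b i) * X b p f)"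
proof (cases "smooth_fun_at AQ p f")
  case True
  have sm: "smooth_fun_at AQ p (\<lambda>q. V i q f)" "smooth_fun_at AQ p (\<lambda>q. X b q f)"
    "smooth_fun_at AQ p (K b i)" for b
    using smooth_vfield_on_apply_smooth_at[OF smooth_V True p]
      smooth_vfield_on_apply_smooth_at[OF smooth_X True p] smooth_fun_atI[OF smooth_K p] by blast+
  have "X a p (\<lambda>q. Y i q f) = X a p (\<lambda>q. V i q f) + (\<Sum>b\<in>UNIV. X a p (\<lambda>q. K b i q * X b q f))"
    unfolding orth_field_def
    by (simp add: tangent_vector_add[OF AQ X_tangent[OF p]] tangent_vector_sum[OF AQ X_tangent[OF p]]
        smooth_fun_at_sum[OF AQ] smooth_fun_at_mult[OF AQ] sm)
  also have "(\<Sum>b\<in>UNIV. X a p (\<lambda>q. K b i q * X b q f)) =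
      (\<Sum>b\<in>UNIV. K b i p * X a p (\<lambda>q. X b q f)) + (\<Sum>b\<in>UNIV. X a p (K b i) * X b p f)"
    by (simp add: tangent_vector_mult[OF AQ X_tangent[OF p]] sm sum.distrib)
  finally have 1: "X a p (\<lambda>q. Y i q f) = X a p (\<lambda>q. V i q f) +
      (\<Sum>b\<in>UNIV. K b i p * X a p (\<lambda>q. X b q f)) + (\<Sum>b\<in>UNIV. X a p (K b i) * X b p f)"
    by simp
  have "X a p (\<lambda>q. V i q f) = V i p (\<lambda>q. X a q f)"
    using fun_cong[OF lie_bracket_X_V[OF p], of a i f] True by (simp add: lie_bracket_def)
  then show ?thesis
    using 1 True
    by (simp add: lie_bracket_def orth_field_def right_diff_distrib sum_subtractf)
next
  case False
  then show ?thesis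
    using tangent_vector_not_smooth[OF X_tangent[OF p]] by (simp add: lie_bracket_def)
qed

text \<open>By \<open>lie_bracket_Y_X\<close> the vector
  \<open>[Y i, X a] + K\<^sup>b\<^sub>i [X a, X b]\<close> is horizontal, so its part along the
  \<open>Y k\<close> is a combination of the lifts, which is the situation of
  \<open>vertical_part_zero\<close>.\<close>

lemma structure_functions_V:
  assumes R: "structure_functions_on AQ U (frame X Y) R" and p: "p \<in> U"
  shows "(\<Sum>k\<in>UNIV. (R (Inr k) (Inr i) (Inl a) p + (\<Sum>b\<in>UNIV. K b i p * R (Inr k) (Inl a) (Inl b) p)) *
    g p (X d p) (V k p)) = 0"
proof (rule vertical_part_zero[OF p])
  fix f
  have R': "lie_bracket AQ (frame X Y \<alpha>) (frame X Y \<beta>) p f =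
      (\<Sum>b\<in>UNIV. R (Inl b) \<alpha> \<beta> p * X b p f) + (\<Sum>k\<in>UNIV. R (Inr k) \<alpha> \<beta> p * Y k p f)" for \<alpha> \<beta>
    using R p unfolding structure_functions_on_def by (simp add: lincomb_frame)
  have "(\<Sum>k\<in>UNIV. (R (Inr k) (Inr i) (Inl a) p + (\<Sum>b\<in>UNIV. K b i p * R (Inr k) (Inl a) (Inl b) p)) * Y k p f) =
      (\<Sum>k\<in>UNIV. R (Inr k) (Inr i) (Inl a) p * Y k p f) +
      (\<Sum>b\<in>UNIV. K b i p * (\<Sum>k\<in>UNIV. R (Inr k) (Inl a) (Inl b) p * Y k p f))"
    by (simp add: distrib_right sum.distrib sum_distrib_left sum_distrib_right mult.assoc) (rule sum.swap)
  also have "\<dots> = (lie_bracket AQ (Y i) (X a) p f - (\<Sum>d\<in>UNIV. R (Inl d) (Inr i) (Inl a) p * X d p f)) +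
      (\<Sum>b\<in>UNIV. K b i p * (lie_bracket AQ (X a) (X b) p f - (\<Sum>d\<in>UNIV. R (Inl d) (Inl a) (Inl b) p * X d p f)))"
    using R'[of "Inr i" "Inl a"] R'[of "Inl a" "Inl b" for b] by (simp add: frame_def)
  also have "\<dots> = - (\<Sum>b\<in>UNIV. X a p (K b i) * X b p f) - (\<Sum>d\<in>UNIV. R (Inl d) (Inr i) (Inl a) p * X d p f) -
      (\<Sum>b\<in>UNIV. K b i p * (\<Sum>d\<in>UNIV. R (Inl d) (Inl a) (Inl b) p * X d p f))"
    by (simp add: lie_bracket_Y_X[OF p] right_diff_distrib sum_subtractf)
  also have "(\<Sum>b\<in>UNIV. K b i p * (\<Sum>d\<in>UNIV. R (Inl d) (Inl a) (Inl b) p * X d p f)) =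
      (\<Sum>d\<in>UNIV. (\<Sum>b\<in>UNIV. K b i p * R (Inl d) (Inl a) (Inl b) p) * X d p f)"
    by (simp add: sum_distrib_left sum_distrib_right mult.assoc) (rule sum.swap)
  finally show "(\<Sum>k\<in>UNIV. (R (Inr k) (Inr i) (Inl a) p + (\<Sum>b\<in>UNIV. K b i p * R (Inr k) (Inl a) (Inl b) p)) * Y k p f) =
      (\<Sum>d\<in>UNIV. (- X a p (K d i) - R (Inl d) (Inr i) (Inl a) p -
        (\<Sum>b\<in>UNIV. K b i p * R (Inl d) (Inl a) (Inl b) p)) * X d p f)"
    by (simp add: left_diff_distrib sum_subtractf sum_negf)
qed

section \<open>Levi-Civita connection, Killing identity and the first two terms of (B')\<close>

context
  fixes nabla \<Gamma>
  assumes nabla: "levi_civita AQ g nabla"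
    and \<Gamma>: "connection_coefficients_on nabla U X Y \<Gamma>"
begin

lemma nabla_tangent:
  assumes "smooth_vfield_on AQ U Z" "smooth_vfield_on AQ U W" "p \<in> U"
  shows "nabla Z W p \<in> tangent_space AQ p"
  using smooth_vfield_onD(2)[OF levi_civitaD(1)[OF nabla assms(1,2)] assms(3)] .

lemma nabla_X_V:
  assumes p: "p \<in> U"
  shows "nabla (X a) (V i) p = nabla (V i) (X a) p"
proof
  fix f
  have "nabla (X a) (V i) p f - nabla (V i) (X a) p f = lie_bracket AQ (X a) (V i) p f"
    unfolding levi_civitaD(2)[OF nabla smooth_X smooth_V p] ..
  then show "nabla (X a) (V i) p f = nabla (V i) (X a) p f"
    by (simp add: lie_bracket_X_V[OF p])
qed

lemmas nabla_metric = levi_civitaD(3)[OF nabla]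

text \<open>Metric compatibility along \<open>V i\<close> together with \<open>V_gram\<close> gives
  skewness of \<open>g(X b, nabla (V i) (X a))\<close>. Vanishing torsion and the commuting fields
  exchange the two arguments of \<open>nabla\<close>.\<close>

lemma V_killing:
  assumes p: "p \<in> U"
  shows "g p (X b p) (nabla (X a) (V i) p) = - g p (X a p) (nabla (X b) (V i) p)"
  using nabla_metric[OF smooth_V smooth_X smooth_X p, of i a b] V_gram[OF p, of i a b]
    g_sym[OF X_tangent[OF p] nabla_tangent[OF smooth_V smooth_X p], of b i a]
  by (simp add: nabla_X_V[OF p])

lemma nabla_coefficients:
  assumes p: "p \<in> U"
  shows "g p (nabla (X a) (X b) p) (X d p) = (\<Sum>e\<in>UNIV. \<Gamma> (Inl e) a b p * g p (X e p) (X d p))"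
    and "g p (nabla (X a) (X b) p) (Y i p) = (\<Sum>k\<in>UNIV. \<Gamma> (Inr k) a b p * g p (Y k p) (Y i p))"
proof -
  have eq: "g p (nabla (X a) (X b) p) w =
      (\<Sum>e\<in>UNIV. \<Gamma> (Inl e) a b p * g p (X e p) w) + (\<Sum>k\<in>UNIV. \<Gamma> (Inr k) a b p * g p (Y k p) w)"
    if w: "w \<in> tangent_space AQ p" for w
  proof -
    have fr: "frame X Y \<gamma> p \<in> tangent_space AQ p" for \<gamma>
      using X_tangent[OF p] Y_tangent[OF p] by (cases \<gamma>) (simp_all add: frame_def)
    have "nabla (X a) (X b) p = lincomb (\<lambda>\<gamma>. \<Gamma> \<gamma> a b p) (\<lambda>\<gamma>. frame X Y \<gamma> p)"
      using \<Gamma> p unfolding connection_coefficients_on_def by blast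
    then have "g p (nabla (X a) (X b) p) w = (\<Sum>\<gamma>\<in>UNIV. \<Gamma> \<gamma> a b p * g p (frame X Y \<gamma> p) w)"
      using tensor2_lincomb_left[OF AQ g_tensor w fr] by simp
    \<comment> \<open>To split the sum over the sum type, \<open>lincomb_frame\<close> is reused
      with real numbers disguised as fields that ignore the point and the function; hence the
      argument \<open>undefined\<close>.\<close>
    also have "\<dots> = lincomb (\<lambda>\<gamma>. \<Gamma> \<gamma> a b p)
        (\<lambda>\<gamma>. frame (\<lambda>e _ _. g p (X e p) w) (\<lambda>k _ _. g p (Y k p) w) \<gamma> p) undefined"
      unfolding lincomb_def by (intro sum.cong refl) (auto simp: frame_def split: sum.split)
    also have "\<dots> = (\<Sum>e\<in>UNIV. \<Gamma> (Inl e) a b p * g p (X e p) w) + (\<Sum>k\<in>UNIV. \<Gamma> (Inr k) a b p * g p (Y k p) w)"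
      by (rule lincomb_frame)
    finally show ?thesis .
  qed
  show "g p (nabla (X a) (X b) p) (X d p) = (\<Sum>e\<in>UNIV. \<Gamma> (Inl e) a b p * g p (X e p) (X d p))"
    using eq[OF X_tangent[OF p]] g_X_Y[OF p] g_sym[OF X_tangent[OF p] Y_tangent[OF p]] by simp
  show "g p (nabla (X a) (X b) p) (Y i p) = (\<Sum>k\<in>UNIV. \<Gamma> (Inr k) a b p * g p (Y k p) (Y i p))"
    using eq[OF Y_tangent[OF p]] g_X_Y[OF p] by simp
qed

text \<open>Since \<open>V i = Y i - K\<^sup>e\<^sub>i X\<^sub>e\<close>, the horizontal
  coefficients supply the pairing with the \<open>X e\<close> and the orthogonal ones the pairing
  with \<open>Y i\<close>. This is how the acceleration part of the nonholonomic field and the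
  multiplier fit together.\<close>

lemma christoffel_V:
  assumes p: "p \<in> U"
  shows "(\<Sum>d\<in>UNIV. \<Gamma> (Inl d) a b p * g p (X d p) (V i p)) +
      (\<Sum>k\<in>UNIV. \<Gamma> (Inr k) a b p * g p (Y k p) (Y i p)) = g p (nabla (X a) (X b) p) (V i p)"
proof -
  let ?n = "nabla (X a) (X b) p"
  have n: "?n \<in> tangent_space AQ p"
    by (rule nabla_tangent[OF smooth_X smooth_X p])
  have "(\<Sum>d\<in>UNIV. \<Gamma> (Inl d) a b p * g p (X d p) (V i p)) =
      - (\<Sum>d\<in>UNIV. \<Gamma> (Inl d) a b p * (\<Sum>e\<in>UNIV. g p (X d p) (X e p) * K e i p))"
    by (simp add: gram_K[OF p] sum_negf)
  also have "\<dots> = - (\<Sum>e\<in>UNIV. K e i p * (\<Sum>d\<in>UNIV. \<Gamma> (Inl d) a b p * g p (X d p) (X e p)))"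
    by (simp add: sum_distrib_left mult_ac) (rule sum.swap)
  also have "\<dots> = - (\<Sum>e\<in>UNIV. K e i p * g p ?n (X e p))"
    by (simp add: nabla_coefficients(1)[OF p])
  finally show ?thesis
    using g_orth_field[OF p n, of i] nabla_coefficients(2)[OF p, of a b i] by simp
qed

text \<open>The position part contributes \<open>- X a (g(X b, V i))\<close>, the velocity part and
  the multiplier contribute \<open>g(nabla (X a) (X b), V i)\<close> by
  \<open>christoffel_V\<close>. Metric compatibility leaves a quadratic form that is skew by
  \<open>V_killing\<close>.\<close>

lemma nonholonomic_field_multiplier:
  assumes p: "p \<in> U" and gb: "\<And>p a i. p \<in> U \<Longrightarrow> gb p (X a p) (Y i p) = - g p (X a p) (V i p)"
  shows "nonholonomic_field X \<Gamma> (theta gb X Y i) p v + multiplier g Y \<Gamma> i p v = 0"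
proof -
  let ?G = "\<lambda>a q. g q (X a q) (V i q)"
  have th: "theta gb X Y i q w = (\<Sum>b\<in>UNIV. - (w $ b) * ?G b q)" if "q \<in> U" for q w
    using that by (simp add: theta_def gb mult.commute)
  have smG: "smooth_fun_at AQ p (?G b)" for b
    by (rule smooth_fun_atI[OF smooth_mixed_gram p])
  have sm: "smooth_fun_at AQ p (\<lambda>q. - (v $ b) * ?G b q)" for b
    by (rule smooth_fun_at_mult[OF AQ smooth_fun_at_const smG])
  have 1: "X a p (\<lambda>q. theta gb X Y i q v) = - (\<Sum>b\<in>UNIV. v $ b * X a p (?G b))" for a
  proof -
    \<comment> \<open>The formula for \<open>theta\<close> holds on \<open>U\<close> only; as
      \<open>U\<close> is open, it fixes the germ at \<open>p\<close>.\<close>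
    have "X a p (\<lambda>q. theta gb X Y i q v) = X a p (\<lambda>q. \<Sum>b\<in>UNIV. - (v $ b) * ?G b q)"
      by (rule tangent_vector_cong[OF AQ X_tangent[OF p] open_U p]) (rule th)
    also have "\<dots> = (\<Sum>b\<in>UNIV. X a p (\<lambda>q. - (v $ b) * ?G b q))"
      by (rule tangent_vector_sum[OF AQ X_tangent[OF p] sm])
    also have "\<dots> = (\<Sum>b\<in>UNIV. - (v $ b) * X a p (?G b))"
      by (simp only: tangent_vector_cmult[OF AQ X_tangent[OF p] smG])
    finally show ?thesis
      by (simp add: sum_negf)
  qed
  have "bounded_linear (theta gb X Y i p)"
    unfolding theta_def
    by (intro bounded_linear_sum bounded_linear_const_mult bounded_linear_vec_nth)
  then have "(theta gb X Y i p has_derivative theta gb X Y i p) (at v)"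
    by (rule bounded_linear_imp_has_derivative)
  \<comment> \<open>In the velocity \<open>theta\<close> is linear and hence its own
    derivative.\<close>
  then have "frechet_derivative (theta gb X Y i p) (at v) = theta gb X Y i p"
    by (rule frechet_derivative_at[symmetric])
  then have 2: "frechet_derivative (theta gb X Y i p) (at v) (axis d 1) = - ?G d p" for d
    by (simp add: th[OF p] axis_def sum_negf flip: of_bool_def)
  have metric: "X a p (?G b) = g p (nabla (X a) (X b) p) (V i p) + g p (X b p) (nabla (X a) (V i) p)" for a b
    by (rule nabla_metric[OF smooth_X smooth_X smooth_V p])
  let ?q = "\<lambda>h. \<Sum>a\<in>UNIV. \<Sum>b\<in>UNIV. v $ a * v $ b * h a b"
  have A: "(\<Sum>a\<in>UNIV. v $ a * X a p (\<lambda>q. theta gb X Y i q v)) = - ?q (\<lambda>a b. X a p (?G b))"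
    by (simp add: 1 sum_distrib_left sum_negf mult.assoc)
  have B: "(\<Sum>d\<in>UNIV. (- (\<Sum>a\<in>UNIV. \<Sum>b\<in>UNIV. \<Gamma> (Inl d) a b p * v $ a * v $ b)) * - ?G d p) =
      ?q (\<lambda>a b. \<Sum>d\<in>UNIV. \<Gamma> (Inl d) a b p * ?G d p)"
  proof -
    have "(\<Sum>d\<in>UNIV. (- (\<Sum>a\<in>UNIV. \<Sum>b\<in>UNIV. \<Gamma> (Inl d) a b p * v $ a * v $ b)) * - ?G d p) =
        (\<Sum>d\<in>UNIV. \<Sum>a\<in>UNIV. \<Sum>b\<in>UNIV. v $ a * v $ b * (\<Gamma> (Inl d) a b p * ?G d p))"
      by (simp add: sum_distrib_left sum_distrib_right sum_negf mult_ac)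
    also have "\<dots> = (\<Sum>a\<in>UNIV. \<Sum>d\<in>UNIV. \<Sum>b\<in>UNIV. v $ a * v $ b * (\<Gamma> (Inl d) a b p * ?G d p))"
      by (rule sum.swap)
    also have "\<dots> = (\<Sum>a\<in>UNIV. \<Sum>b\<in>UNIV. \<Sum>d\<in>UNIV. v $ a * v $ b * (\<Gamma> (Inl d) a b p * ?G d p))"
      by (rule sum.cong[OF refl], rule sum.swap)
    finally show ?thesis
      by (simp add: sum_distrib_left)
  qed
  have C: "multiplier g Y \<Gamma> i p v = ?q (\<lambda>a b. \<Sum>k\<in>UNIV. \<Gamma> (Inr k) a b p * g p (Y k p) (Y i p))"
  proof -
    have "multiplier g Y \<Gamma> i p v =
        (\<Sum>k\<in>UNIV. \<Sum>a\<in>UNIV. \<Sum>b\<in>UNIV. v $ a * v $ b * (\<Gamma> (Inr k) a b p * g p (Y k p) (Y i p)))"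
      unfolding multiplier_def by (simp add: mult_ac)
    also have "\<dots> = (\<Sum>a\<in>UNIV. \<Sum>k\<in>UNIV. \<Sum>b\<in>UNIV. v $ a * v $ b * (\<Gamma> (Inr k) a b p * g p (Y k p) (Y i p)))"
      by (rule sum.swap)
    also have "\<dots> = (\<Sum>a\<in>UNIV. \<Sum>b\<in>UNIV. \<Sum>k\<in>UNIV. v $ a * v $ b * (\<Gamma> (Inr k) a b p * g p (Y k p) (Y i p)))"
      by (rule sum.cong[OF refl], rule sum.swap)
    finally show ?thesis
      by (simp add: sum_distrib_left)
  qed
  have "nonholonomic_field X \<Gamma> (theta gb X Y i) p v + multiplier g Y \<Gamma> i p v =
      - ?q (\<lambda>a b. X a p (?G b)) + ?q (\<lambda>a b. \<Sum>d\<in>UNIV. \<Gamma> (Inl d) a b p * ?G d p) +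
      ?q (\<lambda>a b. \<Sum>k\<in>UNIV. \<Gamma> (Inr k) a b p * g p (Y k p) (Y i p))"
    unfolding nonholonomic_field_def 2 A B C ..
  also have "\<dots> = - ?q (\<lambda>a b. X a p (?G b)) + ?q (\<lambda>a b. g p (nabla (X a) (X b) p) (V i p))"
    unfolding christoffel_V[OF p, symmetric] by (simp add: distrib_left sum.distrib)
  also have "\<dots> = - ?q (\<lambda>a b. g p (X b p) (nabla (X a) (V i) p))"
    unfolding metric by (simp add: distrib_left sum.distrib)
  also have "?q (\<lambda>a b. g p (X b p) (nabla (X a) (V i) p)) = 0"
  proof -
    \<comment> \<open>Exchanging \<open>a\<close> and \<open>b\<close> preserves the quadratic form,
      while the Killing identity reverses its sign.\<close>
    have "?q (\<lambda>a b. g p (X b p) (nabla (X a) (V i) p)) = ?q (\<lambda>a b. g p (X a p) (nabla (X b) (V i) p))"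
      by (subst sum.swap) (simp add: mult.commute)
    also have "\<dots> = - ?q (\<lambda>a b. g p (X b p) (nabla (X a) (V i) p))"
      unfolding V_killing[OF p, of _ _ i, symmetric] by (subst V_killing[OF p]) (simp add: sum_negf)
    finally show ?thesis by simp
  qed
  finally show ?thesis by simp
qed

end

text \<open>The free index of (A') is summed against \<open>K\<close>. By \<open>gram_K\<close> the
  factor \<open>g\<^sub>b\<^sub>d v\<^sup>b\<close> becomes \<open>\<theta>\<^sub>i\<close>, and the
  left-hand sum over \<open>d\<close> is what \<open>Y i\<close> gives on a function constant along
  the fibres.\<close>

lemma condition_A_contracted:
  assumes A: "condition_A U g X Y R gb F" and p: "p \<in> U"
    and gb: "\<And>p a i. p \<in> U \<Longrightarrow> gb p (X a p) (Y i p) = - g p (X a p) (V i p)"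
  shows "(\<Sum>a\<in>UNIV. \<Sum>b\<in>UNIV. g p (X a p) (X b p) * v $ a * v $ b) * (\<Sum>d\<in>UNIV. K d i p * X d p F) =
    theta gb X Y i p v * (\<Sum>a\<in>UNIV. X a p F * v $ a) -
    (\<Sum>k\<in>UNIV. \<Sum>a\<in>UNIV. theta gb X Y k p v * (\<Sum>d\<in>UNIV. K d i p * R (Inr k) (Inl a) (Inl d) p) * v $ a)"
proof -
  let ?\<theta> = "\<lambda>k. theta gb X Y k p v"
  let ?E = "\<Sum>a\<in>UNIV. \<Sum>b\<in>UNIV. g p (X a p) (X b p) * v $ a * v $ b"
  let ?F = "\<Sum>a\<in>UNIV. X a p F * v $ a"
  have A': "?E * X d p F - (\<Sum>b\<in>UNIV. g p (X b p) (X d p) * v $ b) * ?F +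
      (\<Sum>k\<in>UNIV. \<Sum>a\<in>UNIV. ?\<theta> k * R (Inr k) (Inl a) (Inl d) p * v $ a) = 0" for d
  proof -
    \<comment> \<open>The two Kronecker deltas collapse: one produces the kinetic form times
      \<open>X d p F\<close>, the other separates into a momentum factor and the derivative of
      \<open>F\<close> along \<open>v\<close>.\<close>
    have inner: "(\<Sum>e\<in>UNIV. g p (X b p) (X e p) *
        ((if a = e then 1 else 0) * X d p F - (if d = e then 1 else 0) * X a p F) * v $ a * v $ b) =
        g p (X b p) (X a p) * X d p F * v $ a * v $ b - g p (X b p) (X d p) * X a p F * v $ a * v $ b" for a b
    proof -
      have "(\<Sum>e\<in>UNIV. g p (X b p) (X e p) *
          ((if a = e then 1 else 0) * X d p F - (if d = e then 1 else 0) * X a p F) * v $ a * v $ b) =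
          (\<Sum>e\<in>UNIV. (if a = e then g p (X b p) (X e p) * X d p F * v $ a * v $ b else 0) -
            (if d = e then g p (X b p) (X e p) * X a p F * v $ a * v $ b else 0))"
        by (intro sum.cong refl) (simp add: algebra_simps)
      then show ?thesis
        by (simp add: sum_subtractf)
    qed
    have "(\<Sum>a\<in>UNIV. \<Sum>b\<in>UNIV. g p (X b p) (X a p) * X d p F * v $ a * v $ b) = ?E * X d p F"
      using g_sym[OF X_tangent[OF p] X_tangent[OF p]]
      by (simp add: sum_distrib_left sum_distrib_right mult_ac)
    moreover have "(\<Sum>a\<in>UNIV. \<Sum>b\<in>UNIV. g p (X b p) (X d p) * X a p F * v $ a * v $ b) =
        (\<Sum>b\<in>UNIV. g p (X b p) (X d p) * v $ b) * ?F"
      by (simp add: sum_product mult_ac)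
    ultimately have lhs: "(\<Sum>a\<in>UNIV. \<Sum>b\<in>UNIV. \<Sum>e\<in>UNIV. g p (X b p) (X e p) *
        ((if a = e then 1 else 0) * X d p F - (if d = e then 1 else 0) * X a p F) * v $ a * v $ b) =
        ?E * X d p F - (\<Sum>b\<in>UNIV. g p (X b p) (X d p) * v $ b) * ?F"
      unfolding inner by (simp add: sum_subtractf)
    show ?thesis
      using A[unfolded condition_A_def, rule_format, OF p, of d v] unfolding lhs .
  qed
  have "(\<Sum>d\<in>UNIV. K d i p * (?E * X d p F - (\<Sum>b\<in>UNIV. g p (X b p) (X d p) * v $ b) * ?F +
      (\<Sum>k\<in>UNIV. \<Sum>a\<in>UNIV. ?\<theta> k * R (Inr k) (Inl a) (Inl d) p * v $ a))) = 0"
    unfolding A' by simp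
  moreover have "(\<Sum>d\<in>UNIV. K d i p * (\<Sum>b\<in>UNIV. g p (X b p) (X d p) * v $ b)) = ?\<theta> i"
  proof -
    have "(\<Sum>d\<in>UNIV. K d i p * (\<Sum>b\<in>UNIV. g p (X b p) (X d p) * v $ b)) =
        (\<Sum>b\<in>UNIV. (\<Sum>d\<in>UNIV. g p (X b p) (X d p) * K d i p) * v $ b)"
      by (simp add: sum_distrib_left sum_distrib_right mult_ac) (rule sum.swap)
    then show ?thesis
      by (simp add: gram_K[OF p] theta_def gb[OF p])
  qed
  moreover have "(\<Sum>d\<in>UNIV. K d i p * (\<Sum>k\<in>UNIV. \<Sum>a\<in>UNIV. ?\<theta> k * R (Inr k) (Inl a) (Inl d) p * v $ a)) =
      (\<Sum>k\<in>UNIV. \<Sum>a\<in>UNIV. ?\<theta> k * (\<Sum>d\<in>UNIV. K d i p * R (Inr k) (Inl a) (Inl d) p) * v $ a)"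
  proof -
    have "(\<Sum>d\<in>UNIV. K d i p * (\<Sum>k\<in>UNIV. \<Sum>a\<in>UNIV. ?\<theta> k * R (Inr k) (Inl a) (Inl d) p * v $ a)) =
        (\<Sum>d\<in>UNIV. \<Sum>k\<in>UNIV. \<Sum>a\<in>UNIV. ?\<theta> k * (K d i p * R (Inr k) (Inl a) (Inl d) p) * v $ a)"
      by (simp add: sum_distrib_left mult_ac)
    also have "\<dots> = (\<Sum>k\<in>UNIV. \<Sum>d\<in>UNIV. \<Sum>a\<in>UNIV. ?\<theta> k * (K d i p * R (Inr k) (Inl a) (Inl d) p) * v $ a)"
      by (rule sum.swap)
    also have "\<dots> = (\<Sum>k\<in>UNIV. \<Sum>a\<in>UNIV. \<Sum>d\<in>UNIV. ?\<theta> k * (K d i p * R (Inr k) (Inl a) (Inl d) p) * v $ a)"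
      by (rule sum.cong[OF refl], rule sum.swap)
    finally show ?thesis
      by (simp add: sum_distrib_left sum_distrib_right)
  qed
  moreover have "(\<Sum>d\<in>UNIV. K d i p * (?E * X d p F)) = ?E * (\<Sum>d\<in>UNIV. K d i p * X d p F)"
    by (simp only: sum_distrib_left[where r = ?E] mult.left_commute[of _ ?E])
  moreover have "(\<Sum>d\<in>UNIV. K d i p * ((\<Sum>b\<in>UNIV. g p (X b p) (X d p) * v $ b) * ?F)) =
      (\<Sum>d\<in>UNIV. K d i p * (\<Sum>b\<in>UNIV. g p (X b p) (X d p) * v $ b)) * ?F"
    by (simp only: sum_distrib_right mult.assoc)
  ultimately show ?thesis
    by (simp add: distrib_left right_diff_distrib sum.distrib sum_subtractf)
qed

lemma condition_A_imp_B:
  assumes nabla: "levi_civita AQ g nabla"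
    and R: "structure_functions_on AQ U (frame X Y) R"
    and \<Gamma>: "connection_coefficients_on nabla U X Y \<Gamma>"
    and gb: "\<And>p a i. p \<in> U \<Longrightarrow> gb p (X a p) (Y i p) = - g p (X a p) (V i p)"
    and A: "condition_A U g X Y R gb (f \<circ> \<pi>)"
  shows "condition_B U g X Y R \<Gamma> gb (f \<circ> \<pi>)"
  unfolding condition_B_def
proof (intro ballI allI)
  fix p i and v :: "real ^ 'm"
  assume p: "p \<in> U"
  let ?F = "f \<circ> \<pi>" and ?\<theta> = "\<lambda>k. theta gb X Y k p v"
  let ?KR = "\<lambda>k a. \<Sum>b\<in>UNIV. K b i p * R (Inr k) (Inl a) (Inl b) p"
  have \<theta>: "?\<theta> k = - (\<Sum>d\<in>UNIV. g p (X d p) (V k p) * v $ d)" for k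
    by (simp add: theta_def gb[OF p] sum_negf)
  \<comment> \<open>Up to sign \<open>theta\<close> pairs \<open>V k\<close> with the horizontal
    velocity, so this sum is a combination of the vanishing pairings in
    \<open>structure_functions_V\<close>.\<close>
  have "(\<Sum>k\<in>UNIV. ?\<theta> k * (R (Inr k) (Inr i) (Inl a) p + ?KR k a)) = 0" for a
  proof -
    have "(\<Sum>k\<in>UNIV. ?\<theta> k * (R (Inr k) (Inr i) (Inl a) p + ?KR k a)) =
        - (\<Sum>d\<in>UNIV. v $ d * (\<Sum>k\<in>UNIV. (R (Inr k) (Inr i) (Inl a) p + ?KR k a) * g p (X d p) (V k p)))"
      unfolding \<theta> by (simp only: sum_distrib_left sum_distrib_right sum_negf mult_minus_left mult_ac)
        (subst sum.swap, simp only:)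
    then show ?thesis
      by (simp add: structure_functions_V[OF R p])
  qed
  then have "(\<Sum>a\<in>UNIV. (\<Sum>k\<in>UNIV. ?\<theta> k * (R (Inr k) (Inr i) (Inl a) p + ?KR k a)) * v $ a) = 0"
    by simp
  moreover have "(\<Sum>a\<in>UNIV. (\<Sum>k\<in>UNIV. ?\<theta> k * (R (Inr k) (Inr i) (Inl a) p + ?KR k a)) * v $ a) =
      (\<Sum>k\<in>UNIV. \<Sum>a\<in>UNIV. ?\<theta> k * (R (Inr k) (Inr i) (Inl a) p + ?KR k a) * v $ a)"
    by (simp only: sum_distrib_right) (rule sum.swap)
  \<comment> \<open>Under contraction with \<open>theta\<close>,
    \<open>R\<^sup>k\<^sub>i\<^sub>a\<close> may be replaced by
    \<open>- K\<^sup>b\<^sub>i R\<^sup>k\<^sub>a\<^sub>b\<close>, which is the curvature term of the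
    contracted (A').\<close>
  ultimately have RK: "(\<Sum>k\<in>UNIV. \<Sum>a\<in>UNIV. ?\<theta> k * R (Inr k) (Inr i) (Inl a) p * v $ a) =
      - (\<Sum>k\<in>UNIV. \<Sum>a\<in>UNIV. ?\<theta> k * ?KR k a * v $ a)"
    by (simp only: distrib_left distrib_right sum.distrib add_eq_0_iff2)
  have \<delta>: "(\<Sum>k\<in>UNIV. \<Sum>a\<in>UNIV. ?\<theta> k * ((if k = i then 1 else 0) * X a p ?F) * v $ a) =
      ?\<theta> i * (\<Sum>a\<in>UNIV. X a p ?F * v $ a)"
  proof -
    have "(\<Sum>k\<in>UNIV. \<Sum>a\<in>UNIV. ?\<theta> k * ((if k = i then 1 else 0) * X a p ?F) * v $ a) =
        (\<Sum>k\<in>UNIV. if k = i then \<Sum>a\<in>UNIV. ?\<theta> k * X a p ?F * v $ a else 0)"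
      by (intro sum.cong refl) simp
    then show ?thesis
      by (simp add: sum_distrib_left mult.assoc)
  qed
  \<comment> \<open>The generator part of \<open>Y i\<close> kills a function pulled back from the
    base.\<close>
  have YF: "Y i p ?F = (\<Sum>b\<in>UNIV. K b i p * X b p ?F)"
    using V_pullback[of i p f] by (simp add: orth_field_def)
  have "(\<Sum>k\<in>UNIV. \<Sum>a\<in>UNIV. ?\<theta> k * (R (Inr k) (Inr i) (Inl a) p + (if k = i then 1 else 0) * X a p ?F) * v $ a) =
      (\<Sum>k\<in>UNIV. \<Sum>a\<in>UNIV. ?\<theta> k * R (Inr k) (Inr i) (Inl a) p * v $ a) +
      (\<Sum>k\<in>UNIV. \<Sum>a\<in>UNIV. ?\<theta> k * ((if k = i then 1 else 0) * X a p ?F) * v $ a)"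
    by (simp only: distrib_left distrib_right sum.distrib)
  also have "\<dots> = (\<Sum>a\<in>UNIV. \<Sum>b\<in>UNIV. g p (X a p) (X b p) * v $ a * v $ b) * Y i p ?F"
    unfolding RK \<delta> YF using condition_A_contracted[OF A p gb, of v i] by simp
  also have "\<dots> = (\<Sum>a\<in>UNIV. \<Sum>b\<in>UNIV. g p (X a p) (X b p) * Y i p ?F * v $ a * v $ b)"
    by (simp add: sum_distrib_left sum_distrib_right mult_ac)
  finally show "nonholonomic_field X \<Gamma> (theta gb X Y i) p v + multiplier g Y \<Gamma> i p v +
      (\<Sum>k\<in>UNIV. \<Sum>a\<in>UNIV. ?\<theta> k * (R (Inr k) (Inr i) (Inl a) p + (if k = i then 1 else 0) * X a p ?F) * v $ a) -
      (\<Sum>a\<in>UNIV. \<Sum>b\<in>UNIV. g p (X a p) (X b p) * Y i p ?F * v $ a * v $ b) = 0"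
    using nonholonomic_field_multiplier[OF nabla \<Gamma> p gb, of i v] by simp
qed

end

theorem corollary1:
  fixes AQ :: "('q::{t2_space, second_countable_topology}, real ^ 'n) atlas"
    and AG :: "('g::{t2_space, second_countable_topology}, real ^ 'l) atlas"
    and G :: "'g monoid"
    and act :: "'g \<Rightarrow> 'q \<Rightarrow> 'q"
    and AB :: "('b::{t2_space, second_countable_topology}, real ^ 'm) atlas"
    and \<pi> :: "'q \<Rightarrow> 'b"
    and g gb :: "'q tensor2"
    and D :: "'q \<Rightarrow> 'q tvec set"
    and \<xi> :: "'l \<Rightarrow> 'g tvec"
    and c :: "('b, real ^ 'm) chart"
    and X :: "'m \<Rightarrow> 'q vfield"
    and V Y :: "'l \<Rightarrow> 'q vfield"
    and nabla :: "'q vfield \<Rightarrow> 'q vfield \<Rightarrow> 'q vfield"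
    and R :: "'m + 'l \<Rightarrow> 'm + 'l \<Rightarrow> 'm + 'l \<Rightarrow> 'q \<Rightarrow> real"
    and \<Gamma> :: "'m + 'l \<Rightarrow> 'm \<Rightarrow> 'm \<Rightarrow> 'q \<Rightarrow> real"
    and f :: "'b \<Rightarrow> real"
    and F :: "'q \<Rightarrow> real"
    and U :: "'q set"
  assumes system: "chaplygin_system AQ AG G act AB \<pi> g D"
    and lie_basis: "tvec_basis \<xi> (tangent_space AG \<one>\<^bsub>G\<^esub>)"
    and chart: "c \<in> AB"
    and U: "U = \<pi> -` chart_dom c"
    and X: "\<And>a. horizontal_lift_on AQ AB \<pi> D (chart_dom c) (coord_vfield AB c a) (X a)"
    and V: "\<And>i. V i = infinitesimal_generator AQ G act (\<xi> i)"
    and Y: "Y = orth_field g X V"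
    and nabla: "levi_civita AQ g nabla"
    and R: "structure_functions_on AQ U (frame X Y) R"
    and \<Gamma>: "connection_coefficients_on nabla U X Y \<Gamma>"
    and modification: "D_preserving_modification AQ D g gb"
    and gb: "\<And>p a i. p \<in> U \<Longrightarrow> gb p (X a p) (Y i p) = - g p (X a p) (V i p)"
    and f: "smooth_fun_on AB UNIV f"
    and F: "F = f \<circ> \<pi>"
    and A: "condition_A U g X Y R gb F"
  shows "condition_B U g X Y R \<Gamma> gb F \<and> projective_geodesic_extension U g X Y R \<Gamma> gb F"
proof -
  have "lie_group AG G" and action: "free_proper_action AG G AQ act"
    using system unfolding chaplygin_system_def by blast+
  then have AG: "smooth_atlas AG" "carrier G = UNIV"
    unfolding lie_group_def by blast+
  have V': "V = (\<lambda>i. infinitesimal_generator AQ G act (\<xi> i))"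
    using V by (rule ext)
  have \<xi>: "\<xi> i \<in> tangent_space AG \<one>\<^bsub>G\<^esub>" for i
  proof -
    \<comment> \<open>A basis vector lies in the span that \<open>tvec_basis\<close> equates with
      the tangent space, through Kronecker delta coefficients.\<close>
    have "\<xi> i = lincomb (\<lambda>j. if j = i then 1 else 0) \<xi>"
      by (auto simp: lincomb_def if_distrib[of "\<lambda>x. x * _"] cong: if_cong)
    then show ?thesis
      using lie_basis unfolding tvec_basis_def by blast
  qed
  interpret chaplygin_frame AQ AG G act AB \<pi> g D c X \<xi>
    using system action AG chart X \<xi>
    by (intro chaplygin_frame.intro smooth_action.intro chaplygin_frame_axioms.intro)
      (auto simp: chaplygin_system_def free_proper_action_def)
  have eqs: "V = chaplygin_frame.V AQ G act \<xi>" "U = chaplygin_frame.U \<pi> c"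
    using V' U by (auto simp: V_def U_def)
  have "condition_B U g X Y R \<Gamma> gb F"
    using condition_A_imp_B nabla R \<Gamma> gb A unfolding eqs Y F by blast
  then show ?thesis
    using A by (simp add: projective_geodesic_extension_def)
qed

end
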